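(* For any $t\in[0,\infty)$ and $F\in L^2_{\mathbb{X}}$ with representative $f\in L^2(\mu)$ one has $$P_tF=\mathbb{E}\bigl[f(\mathbb{X}(t))\,\big|\,\mathbb{X}\bigr].$$
   Context: $\mathbb{N}=\{1,2,\ldots\}$. Let $(E_n,\mathcal{B}_n,\mu_n)$, $n\in\mathbb{N}$, be arbitrary probability spaces with product $(E,\mathcal{B},\mu)$. On a probability space $(\Omega,\mathcal{A},\mathbb{P})$ let $\mathbb{X}=(X_n)_{n\in\mathbb{N}}$ and $\mathbb{X}'=(X_n')_{n\in\mathbb{N}}$ be two independent $E$-valued random sequences, each with distribution $\mu$, and let $(Z_k)_{k\in\mathbb{N}}$ be a sequence of independent exponentially distributed random variables with mean one that is independent of $(\mathbb{X},\mathbb{X}')$. For $t\in[0,\infty)$ define $\mathbb{X}(t)=(X_k(t))_{k\in\mathbb{N}}$ by $X_k(t):=X_k$ if $Z_k>t$ and $X_k(t):=X_k'$ if $Z_k\leq t$. Let $\mathcal{F}=\sigma(\mathbb{X})$ and $L^2_{\mathbb{X}}=L^2(\Omega,\mathcal{F},\mathbb{P})$ (real-valued). A representative of $F\in L^2_{\mathbb{X}}$ is a function $f\in L^2(\mu)$ with $F=f(\mathbb{X})$ (it exists and is $\mu$-a.s. unique). For $M\subseteq\mathbb{N}$ let $\mathcal{F}_M=\sigma(X_j,j\in M)$. Infinite Hoeffding decomposition: for $F\in L^2_{\mathbb{X}}$ and finite $M\subseteq\mathbb{N}$ put $F_M:=\sum_{L\subseteq M}(-1)^{|M|-|L|}\mathbb{E}[F\,|\,\mathcal{F}_L]$.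 Then $F=\sum_{|M|<\infty}F_M$, with unconditional convergence in $L^2(\mathbb{P})$ and pairwise orthogonal summands. Ornstein-Uhlenbeck semigroup: $P_tF:=\sum_{M\subseteq\mathbb{N},\,|M|<\infty}e^{-t|M|}F_M$ for $F\in L^2_{\mathbb{X}}$ and $t\geq0$ (convergence in $L^2(\mathbb{P})$). *)

theory Defs
  imports "HOL-Probability.Probability"
begin

text \<open>
  Elements of an \<open>L\<^sup>2\<close> space are represented by functions; equality in \<open>L\<^sup>2\<close> is equality
  almost everywhere.
\<close>

definition L2 :: "'b measure \<Rightarrow> ('b \<Rightarrow> real) set" where
  "L2 M = {g \<in> borel_measurable M. integrable M (\<lambda>x. (g x)\<^sup>2)}"

text \<open>
  Unconditional convergence in \<open>L\<^sup>2\<close>: convergence of the net of all finite partial sums.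
\<close>

definition L2_has_sum :: "'b measure \<Rightarrow> ('i \<Rightarrow> 'b \<Rightarrow> real) \<Rightarrow> 'i set \<Rightarrow> ('b \<Rightarrow> real) \<Rightarrow> bool" where
  "L2_has_sum M u I g \<longleftrightarrow>
     (\<forall>i\<in>I. u i \<in> L2 M) \<and> g \<in> L2 M \<and>
     ((\<lambda>S. \<integral>x. ((\<Sum>i\<in>S. u i x) - g x)\<^sup>2 \<partial>M) \<longlongrightarrow> 0) (finite_subsets_at_top I)"

text \<open>The sum is determined only up to a null set; a version is chosen.\<close>

definition L2_sum :: "'b measure \<Rightarrow> ('i \<Rightarrow> 'b \<Rightarrow> real) \<Rightarrow> 'i set \<Rightarrow> ('b \<Rightarrow> real)" where
  "L2_sum M u I = (SOME g. L2_has_sum M u I g)"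

definition sigma_seq :: "'w measure \<Rightarrow> (nat \<Rightarrow> 'a measure) \<Rightarrow> ('w \<Rightarrow> nat \<Rightarrow> 'a) \<Rightarrow> 'w measure" where
  "sigma_seq M E X = vimage_algebra (space M) X (PiM UNIV E)"

definition sigma_coords ::
    "'w measure \<Rightarrow> (nat \<Rightarrow> 'a measure) \<Rightarrow> ('w \<Rightarrow> nat \<Rightarrow> 'a) \<Rightarrow> nat set \<Rightarrow> 'w measure" where
  "sigma_coords M E X K =
     sigma (space M) (\<Union>j\<in>K. {(\<lambda>\<omega>. X \<omega> j) -` A \<inter> space M | A. A \<in> sets (E j)})"

definition L2_seq ::
    "'w measure \<Rightarrow> (nat \<Rightarrow> 'a measure) \<Rightarrow> ('w \<Rightarrow> nat \<Rightarrow> 'a) \<Rightarrow> ('w \<Rightarrow> real) set" where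
  "L2_seq M E X = L2 (restr_to_subalg M (sigma_seq M E X))"

definition representative ::
    "'w measure \<Rightarrow> (nat \<Rightarrow> 'a measure) \<Rightarrow> ('w \<Rightarrow> nat \<Rightarrow> 'a) \<Rightarrow> ('w \<Rightarrow> real) \<Rightarrow> ((nat \<Rightarrow> 'a) \<Rightarrow> real) \<Rightarrow> bool" where
  "representative M E X F f \<longleftrightarrow> f \<in> L2 (PiM UNIV E) \<and> (AE \<omega> in M. F \<omega> = f (X \<omega>))"

definition hoeffding_term ::
    "'w measure \<Rightarrow> (nat \<Rightarrow> 'a measure) \<Rightarrow> ('w \<Rightarrow> nat \<Rightarrow> 'a) \<Rightarrow> ('w \<Rightarrow> real) \<Rightarrow> nat set \<Rightarrow> 'w \<Rightarrow> real" where
  "hoeffding_term M E X F K \<omega> =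
     (\<Sum>L\<in>Pow K. (- 1) ^ (card K - card L) * real_cond_exp M (sigma_coords M E X L) F \<omega>)"

definition OU_semigroup ::
    "'w measure \<Rightarrow> (nat \<Rightarrow> 'a measure) \<Rightarrow> ('w \<Rightarrow> nat \<Rightarrow> 'a) \<Rightarrow> real \<Rightarrow> ('w \<Rightarrow> real) \<Rightarrow> 'w \<Rightarrow> real" where
  "OU_semigroup M E X t F =
     L2_sum M (\<lambda>K \<omega>. exp (- t * real (card K)) * hoeffding_term M E X F K \<omega>) {K. finite K}"

definition resampled ::
    "('w \<Rightarrow> nat \<Rightarrow> 'a) \<Rightarrow> ('w \<Rightarrow> nat \<Rightarrow> 'a) \<Rightarrow> (nat \<Rightarrow> 'w \<Rightarrow> real) \<Rightarrow> real \<Rightarrow> 'w \<Rightarrow> nat \<Rightarrow> 'a" where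
  "resampled X X' Z t \<omega> = (\<lambda>k. if Z k \<omega> > t then X \<omega> k else X' \<omega> k)"

text \<open>
  The coordinate spaces \<open>E k\<close> may have different carriers inside the common type \<open>'a\<close>, and
  sequences are indexed from \<open>0\<close>. Independence of \<open>(X, X')\<close> and \<open>Z\<close> is expressed by the
  generated sigma-algebras, because \<open>indep_var\<close> requires both variables to have the same type.
\<close>

locale resampling_setting = prob_space M
  for M :: "'w measure" +
  fixes E :: "nat \<Rightarrow> 'a measure"
    and X X' :: "'w \<Rightarrow> nat \<Rightarrow> 'a"
    and Z :: "nat \<Rightarrow> 'w \<Rightarrow> real"
  assumes prob_space_E: "\<And>k. prob_space (E k)"
    and X_measurable: "X \<in> measurable M (PiM UNIV E)"
    and X_distr: "distr M (PiM UNIV E) X = PiM UNIV E"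
    and X'_measurable: "X' \<in> measurable M (PiM UNIV E)"
    and X'_distr: "distr M (PiM UNIV E) X' = PiM UNIV E"
    and X_X'_indep: "indep_var (PiM UNIV E) X (PiM UNIV E) X'"
    and Z_exponential: "\<And>k. distributed M lborel (Z k) (\<lambda>z. ennreal (exponential_density 1 z))"
    and Z_indep: "indep_vars (\<lambda>_. borel) Z UNIV"
    and Z_indep_X_X':
      "indep_set
         (sets (vimage_algebra (space M) (\<lambda>\<omega>. (X \<omega>, X' \<omega>)) (PiM UNIV E \<Otimes>\<^sub>M PiM UNIV E)))
         (sets (vimage_algebra (space M) (\<lambda>\<omega> k. Z k \<omega>) (PiM UNIV (\<lambda>_. borel))))"

end

theory Submission
  imports Defs
begin

text \<open>
  Given \<open>\<X>\<close> and the set \<open>J = {k. Z\<^sub>k > t}\<close> of retained coordinates, \<open>f(\<X>(t))\<close> averages to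
  \<open>\<E>[F | \<F>\<^sub>J]\<close>. If \<open>F\<close> depends on the coordinates in a finite set \<open>N\<close> only, this is the sum of
  the \<open>F\<^sub>K\<close> over \<open>K \<subseteq> J \<inter> N\<close>, and averaging over \<open>J\<close> produces the weights \<open>P(K \<subseteq> J) = exp (- t |K|)\<close>.
  The general case follows by density: the map from \<open>f\<close> to the conditional expectation is an
  \<open>L\<^sup>2\<close>-contraction, and by orthogonality the partial sums outside the subsets of \<open>N\<close> have
  \<open>L\<^sup>2\<close>-norm at most \<open>\<parallel>F - \<E>[F | \<F>\<^sub>N]\<parallel>\<close>.
\<close>

text \<open>Rules for abstract conditional expectations hold up to null sets that vary with the
  sigma-algebra, while the retained set \<open>J\<close> can take uncountably many values. The
  computation is therefore moved to the product space, where \<open>cond L f\<close> is an explicit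
  version that integrates out the coordinates outside \<open>L\<close>. There, a nested average is a
  single average because two successive resamplings agree, point by point, with one. The resulting
  rule, that \<open>cond L\<close> after \<open>cond K\<close> is
  \<open>cond (L \<inter> K)\<close>, makes the inner product of \<open>cond A f\<close> and
  \<open>cond B f\<close> a function of \<open>A \<inter> B\<close> alone; orthogonality of the
  Hoeffding terms is then pure combinatorics of alternating sums. The obstacle in general is that
  \<open>J\<close> may be infinite, so \<open>cond J f\<close> has no finite Hoeffding expansion.
  Replacing \<open>f\<close> by \<open>cond N f\<close> cuts \<open>J\<close> down to the finite set
  \<open>J \<inter> N\<close>. The contraction that pays for this replacement rests on the fact that
  the resampled sequence again has law \<mu>.\<close>

section \<open>Moebius inversion over finite sets\<close>

text \<open>The alternating sum of the Hoeffding terms, detached from measure theory: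
  \<open>a\<close> will be \<open>L\<close> mapped to a conditional expectation, or to an inner
  product with one.\<close>

definition mobius :: "('i set \<Rightarrow> real) \<Rightarrow> 'i set \<Rightarrow> real" where
  "mobius a K = (\<Sum>L\<in>Pow K. (- 1) ^ (card K - card L) * a L)"

lemma sum_mobius:
  assumes "finite N"
  shows "(\<Sum>K\<in>Pow N. mobius a K) = a N"
proof -
  have "a N = (\<Sum>T\<in>Pow N. (-1) ^ card T * ((-1) ^ card T * mobius a T))"
  proof (rule inclusion_exclusion_symmetric)
    fix S :: "'a set" assume "finite S"
    \<comment> \<open>This makes the natural-number subtraction of cardinalities exact, so that its
      parity is that of the sum and the sign splits into two factors.\<close>
    then have "\<not> card S < card T" if "T \<subseteq> S" for T
      using that by (simp add: card_mono not_less)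
    then show "(- 1) ^ card S * mobius a S = (\<Sum>T\<in>Pow S. (- 1) ^ card T * a T)"
      unfolding mobius_def sum_distrib_left
      by (intro sum.cong refl) (auto simp: minus_one_power_iff)
  qed fact
  then show ?thesis
    by (simp flip: mult.assoc power_add)
qed

text \<open>Pairing each \<open>L\<close> without \<open>l\<close> with \<open>insert l L\<close>
  gives equal values of \<open>a\<close> and opposite signs.\<close>

lemma mobius_eq_0:
  assumes "finite K" "l \<in> K" and a: "\<And>L. L \<subseteq> K \<Longrightarrow> a (insert l L) = a L"
  shows "mobius a K = 0"
proof -
  define K' where "K' = K - {l}"
  have K: "K = insert l K'" "l \<notin> K'" "finite K'"
    using assms by (auto simp: K'_def)
  have "mobius a K = (\<Sum>L\<in>Pow K'. (- 1) ^ (card K - card L) * a L) +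
      (\<Sum>L\<in>insert l ` Pow K'. (- 1) ^ (card K - card L) * a L)"
    unfolding mobius_def K(1) Pow_insert
    using K by (intro sum.union_disjoint) auto
  also have "(\<Sum>L\<in>insert l ` Pow K'. (- 1) ^ (card K - card L) * a L) =
      (\<Sum>L\<in>Pow K'. (- 1) ^ (card K - card (insert l L)) * a (insert l L))"
    using K by (subst sum.reindex) (auto simp: inj_on_def)
  also have "\<dots> = (\<Sum>L\<in>Pow K'. - ((- 1) ^ (card K - card L) * a L))"
  proof (intro sum.cong refl)
    fix L assume "L \<in> Pow K'"
    then have L: "L \<subseteq> K'" "finite L" "l \<notin> L" using K finite_subset by auto
    have "card L \<le> card K'" using L K card_mono by blast
    then have "card K - card L = Suc (card K - card (insert l L))"
      using K L by simp
    moreover have "a (insert l L) = a L" using L K by (intro a) auto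
    ultimately show "(- 1) ^ (card K - card (insert l L)) * a (insert l L) =
        - ((- 1) ^ (card K - card L) * a L)" by simp
  qed
  finally show ?thesis by (simp add: sum_negf)
qed

text \<open>If some \<open>l\<close> in \<open>L\<close> lies outside \<open>A\<close>, inserting
  \<open>l\<close> into \<open>B\<close> does not change \<open>A \<inter> B\<close>, and everything
  cancels. With \<open>a\<close> the conditional expectations, this says that conditioning a
  Hoeffding term on the coordinates in \<open>A\<close> either keeps it or kills it.\<close>

lemma mobius_Int:
  assumes "finite L"
  shows "mobius (\<lambda>B. a (A \<inter> B)) L = (if L \<subseteq> A then mobius a L else 0)"
proof (cases "L \<subseteq> A")
  case True
  then show ?thesis
    by (auto simp: mobius_def Int_absorb1 intro!: sum.cong)
next
  case False
  then obtain l where "l \<in> L" "l \<notin> A" by auto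
  then show ?thesis
    using assms False by (auto intro!: mobius_eq_0)
qed

text \<open>The combinatorial core of orthogonality. The inner transform vanishes unless
  \<open>L \<subseteq> A\<close>, and \<open>A\<close> runs through subsets of \<open>K\<close>, so
  \<open>L \<subseteq> K\<close> is forced; exchanging the two sums forces
  \<open>K \<subseteq> L\<close> as well. On the diagonal only \<open>A = K\<close> survives, with
  sign 1.\<close>

lemma mobius_mobius_Int:
  assumes "finite K" "finite L"
  shows "mobius (\<lambda>A. mobius (\<lambda>B. a (A \<inter> B)) L) K = (if K = L then mobius a K else 0)"
proof -
  have not_sub: "mobius (\<lambda>A. mobius (\<lambda>B. a (A \<inter> B)) L) K = 0"
    if "finite L" "\<not> L \<subseteq> K" for K L :: "'a set"
    using that unfolding mobius_def[of _ K] mobius_Int[OF that(1)]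
    by (intro sum.neutral) auto
  have swap: "mobius (\<lambda>A. mobius (\<lambda>B. a (A \<inter> B)) L) K = mobius (\<lambda>A. mobius (\<lambda>B. a (A \<inter> B)) K) L"
    unfolding mobius_def sum_distrib_left
    by (subst sum.swap) (simp add: ac_simps Int_commute)
  consider "\<not> L \<subseteq> K" | "\<not> K \<subseteq> L" | "K = L" by auto
  then show ?thesis
  proof cases
    case 3
    have "mobius (\<lambda>A. mobius (\<lambda>B. a (A \<inter> B)) K) K =
        (\<Sum>A\<in>Pow K. (- 1) ^ (card K - card A) * (if K = A then mobius a K else 0))"
      unfolding mobius_Int[OF assms(1)] mobius_def[of "\<lambda>A. if K \<subseteq> A then mobius a K else 0"]
      by (intro sum.cong refl) (auto dest: subset_antisym)
    also have "\<dots> = (\<Sum>A\<in>Pow K. if K = A then mobius a K else 0)"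
      by (intro sum.cong) auto
    finally show ?thesis
      using assms 3 by simp
  qed (use not_sub swap assms in auto)
qed

section \<open>Square integrable functions\<close>

lemma L2_borel_measurable [measurable_dest]: "f \<in> L2 M \<Longrightarrow> f \<in> borel_measurable M"
  by (simp add: L2_def)

lemma L2_integrable_square: "f \<in> L2 M \<Longrightarrow> integrable M (\<lambda>x. (f x)\<^sup>2)"
  by (simp add: L2_def)

lemma L2_integrable_mult:
  assumes "f \<in> L2 M" "g \<in> L2 M"
  shows "integrable M (\<lambda>x. f x * g x)"
proof (rule Bochner_Integration.integrable_bound)
  show "integrable M (\<lambda>x. (f x)\<^sup>2 + (g x)\<^sup>2)"
    using assms by (auto simp: L2_def)
  show "(\<lambda>x. f x * g x) \<in> borel_measurable M"
    using assms by (auto simp: L2_def)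
  have "\<bar>a * b\<bar> \<le> a\<^sup>2 + b\<^sup>2" for a b :: real
    using sum_squares_bound[of "\<bar>a\<bar>" "\<bar>b\<bar>"] zero_le_mult_iff[of "\<bar>a\<bar>" "\<bar>b\<bar>"]
    unfolding abs_mult power2_abs by linarith
  then show "AE x in M. norm (f x * g x) \<le> norm ((f x)\<^sup>2 + (g x)\<^sup>2)"
    by simp
qed

lemma L2_add:
  assumes "f \<in> L2 M" "g \<in> L2 M"
  shows "(\<lambda>x. f x + g x) \<in> L2 M"
  using assms L2_integrable_mult[OF assms]
  by (auto simp: L2_def power2_sum mult.assoc)

lemma L2_cmult:
  assumes "f \<in> L2 M"
  shows "(\<lambda>x. c * f x) \<in> L2 M"
  using assms by (auto simp: L2_def power_mult_distrib)

lemma L2_diff: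
  assumes "f \<in> L2 M" "g \<in> L2 M"
  shows "(\<lambda>x. f x - g x) \<in> L2 M"
  using L2_add[OF assms(1) L2_cmult[OF assms(2), of "-1"]] by simp

lemma L2_sum_mem:
  assumes "\<And>i. i \<in> I \<Longrightarrow> f i \<in> L2 M"
  shows "(\<lambda>x. \<Sum>i\<in>I. f i x) \<in> L2 M"
  using assms
proof (induction I rule: infinite_finite_induct)
  case (insert i I)
  then show ?case using L2_add[of "f i" M] by simp
qed (auto simp: L2_def)

lemma L2_cong:
  assumes "\<And>x. x \<in> space M \<Longrightarrow> f x = g x"
  shows "f \<in> L2 M \<longleftrightarrow> g \<in> L2 M"
proof -
  have "f \<in> borel_measurable M \<longleftrightarrow> g \<in> borel_measurable M"
    using assms by (rule measurable_cong)
  moreover have "integrable M (\<lambda>x. (f x)\<^sup>2) \<longleftrightarrow> integrable M (\<lambda>x. (g x)\<^sup>2)"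
    using assms by (intro Bochner_Integration.integrable_cong) auto
  ultimately show ?thesis by (simp add: L2_def)
qed

lemma L2_AE_cong:
  assumes "f \<in> L2 M" "g \<in> borel_measurable M" "AE x in M. f x = g x"
  shows "g \<in> L2 M"
proof -
  have "integrable M (\<lambda>x. (f x)\<^sup>2) = integrable M (\<lambda>x. (g x)\<^sup>2)"
    using assms by (intro integrable_cong_AE) (auto simp: L2_def)
  then show ?thesis
    using assms by (auto simp: L2_def)
qed

lemma (in prob_space) L2_integrable:
  assumes "f \<in> L2 M"
  shows "integrable M f"
  using L2_integrable_mult[OF assms, of "\<lambda>_. 1"] by (simp add: L2_def)

lemma (in prob_space) L2_indicator:
  assumes "A \<in> sets M"
  shows "(indicator A :: 'a \<Rightarrow> real) \<in> L2 M"
proof -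
  have "integrable M (indicator A :: 'a \<Rightarrow> real)"
    using assms by (intro integrable_real_indicator) (auto simp: emeasure_eq_measure)
  moreover have "(indicator A x :: real)\<^sup>2 = indicator A x" for x
    by (auto simp: indicator_def)
  ultimately show ?thesis
    using assms by (simp add: L2_def)
qed

lemma (in prob_space) expectation_square_le:
  fixes f :: "'a \<Rightarrow> real"
  assumes "integrable M f" "integrable M (\<lambda>x. (f x)\<^sup>2)"
  shows "(expectation f)\<^sup>2 \<le> expectation (\<lambda>x. (f x)\<^sup>2)"
  using variance_eq[OF assms] variance_positive[of f] by simp

text \<open>Stands in for the triangle inequality, so that all estimates stay with squared norms.
  Its factor 2 on each of two terms is the origin of every \<epsilon>/4 below.\<close>

lemma integral_add_square_le:
  assumes "f \<in> L2 M" "g \<in> L2 M"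
  shows "(\<integral>x. (f x + g x)\<^sup>2 \<partial>M) \<le> 2 * (\<integral>x. (f x)\<^sup>2 \<partial>M) + 2 * (\<integral>x. (g x)\<^sup>2 \<partial>M)"
proof -
  have "(\<integral>x. (f x + g x)\<^sup>2 \<partial>M) \<le> (\<integral>x. 2 * (f x)\<^sup>2 + 2 * (g x)\<^sup>2 \<partial>M)"
  proof (rule integral_mono)
    show "integrable M (\<lambda>x. (f x + g x)\<^sup>2)"
      using L2_add[OF assms] by (simp add: L2_def)
    show "integrable M (\<lambda>x. 2 * (f x)\<^sup>2 + 2 * (g x)\<^sup>2)"
      using assms by (auto simp: L2_def)
    show "(f x + g x)\<^sup>2 \<le> 2 * (f x)\<^sup>2 + 2 * (g x)\<^sup>2" for x
      using sum_squares_bound[of "f x" "g x"] by (simp add: power2_sum)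
  qed
  also have "\<dots> = 2 * (\<integral>x. (f x)\<^sup>2 \<partial>M) + 2 * (\<integral>x. (g x)\<^sup>2 \<partial>M)"
    using assms by (subst Bochner_Integration.integral_add) (auto simp: L2_def)
  finally show ?thesis .
qed

lemma L2_dominated_convergence:
  assumes f: "f \<in> L2 M" and U: "\<And>i::nat. U i \<in> borel_measurable M"
    and bound: "\<And>i x. x \<in> space M \<Longrightarrow> \<bar>U i x\<bar> \<le> \<bar>f x\<bar>"
    and lim: "\<And>x. x \<in> space M \<Longrightarrow> (\<lambda>i. U i x) \<longlonglongrightarrow> f x"
  shows "U i \<in> L2 M" and "(\<lambda>i. \<integral>x. (f x - U i x)\<^sup>2 \<partial>M) \<longlonglongrightarrow> 0"
proof -
  have [measurable]: "f \<in> borel_measurable M" and f2: "integrable M (\<lambda>x. (f x)\<^sup>2)"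
    using f by (auto simp: L2_def)
  note U[measurable]
  have "integrable M (\<lambda>x. (U i x)\<^sup>2)"
    using bound by (intro Bochner_Integration.integrable_bound[OF f2])
      (auto intro!: AE_I2 simp: abs_le_square_iff)
  then show "U i \<in> L2 M"
    using U by (simp add: L2_def)
  have "(\<lambda>i. \<integral>x. (f x - U i x)\<^sup>2 \<partial>M) \<longlonglongrightarrow> (\<integral>x. 0 \<partial>M)"
  proof (rule integral_dominated_convergence)
    \<comment> \<open>The 4 is the square of the 2 in the bound of
      \<open>\<bar>f x - U i x\<bar>\<close> by \<open>2 * \<bar>f x\<bar>\<close>.\<close>
    show "integrable M (\<lambda>x. 4 * (f x)\<^sup>2)"
      using f2 by simp
    show "AE x in M. (\<lambda>i. (f x - U i x)\<^sup>2) \<longlonglongrightarrow> 0"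
    proof (rule AE_I2)
      fix x assume "x \<in> space M"
      then have "(\<lambda>i. (f x - U i x)\<^sup>2) \<longlonglongrightarrow> (f x - f x)\<^sup>2"
        by (intro tendsto_intros lim)
      then show "(\<lambda>i. (f x - U i x)\<^sup>2) \<longlonglongrightarrow> 0" by simp
    qed
    show "AE x in M. norm ((f x - U i x)\<^sup>2) \<le> 4 * (f x)\<^sup>2" for i
    proof (rule AE_I2)
      fix x assume "x \<in> space M"
      then have "\<bar>f x - U i x\<bar> \<le> \<bar>2 * f x\<bar>"
        using bound[of x i] by auto
      then have "(f x - U i x)\<^sup>2 \<le> (2 * f x)\<^sup>2"
        by (simp only: abs_le_square_iff)
      then show "norm ((f x - U i x)\<^sup>2) \<le> 4 * (f x)\<^sup>2"
        by (simp add: power_mult_distrib)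
    qed
  qed auto
  then show "(\<lambda>i. \<integral>x. (f x - U i x)\<^sup>2 \<partial>M) \<longlonglongrightarrow> 0" by simp
qed

text \<open>The difference of the two limits is the difference of their errors at any finite partial
  sum. Its squared norm does not depend on the partial sum, while the bound tends to 0 along the
  net.\<close>

lemma L2_has_sum_unique:
  assumes "L2_has_sum M u I g" "L2_has_sum M u I h"
  shows "AE x in M. g x = h x"
proof -
  let ?S = "\<lambda>S x. \<Sum>i\<in>S. u i x"
  have u: "i \<in> I \<Longrightarrow> u i \<in> L2 M" and g: "g \<in> L2 M" and h: "h \<in> L2 M" for i
    using assms by (auto simp: L2_has_sum_def)
  have gh: "(\<lambda>x. g x - h x) \<in> L2 M"
    using g h by (rule L2_diff)
  have "(\<integral>x. (g x - h x)\<^sup>2 \<partial>M) \<le> 0"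
  proof (rule tendsto_lowerbound)
    show "((\<lambda>S. 2 * (\<integral>x. (?S S x - h x)\<^sup>2 \<partial>M) + 2 * (\<integral>x. (?S S x - g x)\<^sup>2 \<partial>M))
        \<longlongrightarrow> 0) (finite_subsets_at_top I)"
      using assms by (auto simp: L2_has_sum_def intro!: tendsto_eq_intros)
    show "\<forall>\<^sub>F S in finite_subsets_at_top I. (\<integral>x. (g x - h x)\<^sup>2 \<partial>M) \<le>
        2 * (\<integral>x. (?S S x - h x)\<^sup>2 \<partial>M) + 2 * (\<integral>x. (?S S x - g x)\<^sup>2 \<partial>M)"
    proof (rule eventually_finite_subsets_at_top_weakI)
      fix S assume "finite S" "S \<subseteq> I"
      then have S: "?S S \<in> L2 M"
        using u by (intro L2_sum_mem) auto
      have "(\<integral>x. ((?S S x - h x) + (- 1) * (?S S x - g x))\<^sup>2 \<partial>M) \<le>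
          2 * (\<integral>x. (?S S x - h x)\<^sup>2 \<partial>M) + 2 * (\<integral>x. ((- 1) * (?S S x - g x))\<^sup>2 \<partial>M)"
        by (intro integral_add_square_le L2_diff L2_cmult S g h)
      then show "(\<integral>x. (g x - h x)\<^sup>2 \<partial>M) \<le>
        2 * (\<integral>x. (?S S x - h x)\<^sup>2 \<partial>M) + 2 * (\<integral>x. (?S S x - g x)\<^sup>2 \<partial>M)"
        by (simp add: power2_commute[of "g _"])
    qed
  qed simp
  moreover have "(\<integral>x. (g x - h x)\<^sup>2 \<partial>M) \<ge> 0" by simp
  ultimately have "(\<integral>x. (g x - h x)\<^sup>2 \<partial>M) = 0" by linarith
  then have "AE x in M. (g x - h x)\<^sup>2 = 0"
    using gh by (subst (asm) integral_nonneg_eq_0_iff_AE) (auto simp: L2_def)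
  then show ?thesis by simp
qed

text \<open>Reduces a claim about the chosen version to exhibiting one function to which the partial
  sums converge.\<close>

lemma AE_L2_sum_eq:
  assumes "L2_has_sum M u I g"
  shows "AE x in M. L2_sum M u I x = g x"
  using assms L2_has_sum_unique someI[of "L2_has_sum M u I" g] unfolding L2_sum_def by blast

section \<open>Averaging out coordinates of a product space\<close>

text \<open>The set \<open>L\<close> may depend on \<open>w\<close>: this covers both averaging over
  a fixed set of coordinates and the random set of coordinates retained by the clocks. In
  \<open>override_on g f L\<close> the values come from \<open>f\<close> on \<open>L\<close> and
  from \<open>g\<close> elsewhere.\<close>

lemma measurable_override_on:
  assumes [measurable]: "f \<in> measurable N (PiM UNIV E)" "g \<in> measurable N (PiM UNIV E)"
    and [measurable]: "\<And>k. Measurable.pred N (\<lambda>w. k \<in> L w)"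
  shows "(\<lambda>w. override_on (g w) (f w) (L w)) \<in> measurable N (PiM UNIV E)"
proof (rule measurable_PiM_single')
  fix k
  have "(\<lambda>w. if k \<in> L w then f w k else g w k) \<in> measurable N (E k)"
    by measurable
  then show "(\<lambda>w. override_on (g w) (f w) (L w) k) \<in> measurable N (E k)"
    by (simp add: override_on_def)
next
  have "f w \<in> space (PiM UNIV E)" "g w \<in> space (PiM UNIV E)" if "w \<in> space N" for w
    using that assms(1,2)[THEN measurable_space] by auto
  then show "(\<lambda>w. override_on (g w) (f w) (L w)) \<in> space N \<rightarrow> (\<Pi>\<^sub>E i\<in>UNIV. space (E i))"
    by (auto simp: space_PiM override_on_def PiE_iff)
qed

text \<open>All functions are compared, not only points of the product space. Rewriting under
  \<open>override_on\<close> then needs no side condition; the price is that functions known only on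
  the space must first be replaced by an extension of this kind.\<close>

definition depends_only_on :: "'i set \<Rightarrow> (('i \<Rightarrow> 'a) \<Rightarrow> 'b) \<Rightarrow> bool" where
  "depends_only_on L g \<longleftrightarrow> (\<forall>x x'. (\<forall>k\<in>L. x k = x' k) \<longrightarrow> g x = g x')"

lemma depends_only_on_override_on:
  "depends_only_on L g \<Longrightarrow> g (override_on y x L) = g x"
  unfolding depends_only_on_def by (metis override_on_apply_in)

locale full_product_prob_space = product_prob_space E "UNIV :: 'i set"
  for E :: "'i \<Rightarrow> 'a measure"
begin

abbreviation "\<mu> \<equiv> PiM UNIV E"

sublocale pair: pair_prob_space \<mu> \<mu> ..

lemma measurable_override_on_pair [measurable]:
  "(\<lambda>p. override_on (snd p) (fst p) L) \<in> measurable (\<mu> \<Otimes>\<^sub>M \<mu>) \<mu>"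
  by (intro measurable_override_on) measurable

lemma override_on_in_space:
  assumes "x \<in> space \<mu>" "y \<in> space \<mu>"
  shows "override_on y x L \<in> space \<mu>"
  using assms by (auto simp: space_PiM override_on_def PiE_iff)

text \<open>The preimage of a cylinder over \<open>J\<close> is a rectangle:
  \<open>J \<inter> L\<close> constrains the first copy and \<open>J - L\<close> the second, and the
  two products of probabilities recombine. This is the resampling statement for a deterministic set
  of retained coordinates.\<close>

lemma distr_override_on: "distr (\<mu> \<Otimes>\<^sub>M \<mu>) \<mu> (\<lambda>p. override_on (snd p) (fst p) L) = \<mu>"
proof (rule PiM_eq)
  fix J :: "'i set" and F
  assume J: "finite J" and F: "\<And>j. j \<in> J \<Longrightarrow> F j \<in> sets (E j)"
  let ?C = "\<lambda>J. {x \<in> space \<mu>. \<forall>j\<in>J. x j \<in> F j}"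
  have C: "prod_emb UNIV E J (Pi\<^sub>E J F) = ?C J"
    by (auto simp: prod_emb_def space_PiM)
  have sets: "?C J' \<in> sets \<mu>" if "J' \<subseteq> J" for J'
    using that F J by (intro sets.sets_Collect_finite_All sets_Collect_single')
      (auto dest: finite_subset sets.Int_space_eq2)
  have "(\<lambda>p. override_on (snd p) (fst p) L) -` ?C J \<inter> space (\<mu> \<Otimes>\<^sub>M \<mu>) = ?C (J \<inter> L) \<times> ?C (J - L)"
    by (auto simp: space_pair_measure override_on_in_space)
       (auto simp: override_on_def split: if_splits)
  then have "emeasure (distr (\<mu> \<Otimes>\<^sub>M \<mu>) \<mu> (\<lambda>p. override_on (snd p) (fst p) L)) (?C J) =
      emeasure \<mu> (?C (J \<inter> L)) * emeasure \<mu> (?C (J - L))"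
    using sets by (simp add: emeasure_distr P.emeasure_pair_measure_Times)
  also have "\<dots> = (\<Prod>j\<in>J \<inter> L. emeasure (E j) (F j)) * (\<Prod>j\<in>J - L. emeasure (E j) (F j))"
    using J F by (intro arg_cong2[where f = times] emeasure_PiM_Collect) auto
  also have "\<dots> = (\<Prod>j\<in>J. emeasure (E j) (F j))"
    using J by (subst prod.union_disjoint[symmetric]) (auto intro!: prod.cong)
  finally show "emeasure (distr (\<mu> \<Otimes>\<^sub>M \<mu>) \<mu> (\<lambda>p. override_on (snd p) (fst p) L))
      (prod_emb UNIV E J (Pi\<^sub>E J F)) = (\<Prod>j\<in>J. emeasure (E j) (F j))"
    unfolding C .
qed simp

text \<open>A version of the conditional expectation given the coordinates in \<open>L\<close>,
  defined at every point. Where the section is not integrable, the integral takes its default value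
  0; hence additive rules for it hold only almost everywhere.\<close>

definition cond :: "'i set \<Rightarrow> (('i \<Rightarrow> 'a) \<Rightarrow> real) \<Rightarrow> ('i \<Rightarrow> 'a) \<Rightarrow> real" where
  "cond L f x = (\<integral>y. f (override_on y x L) \<partial>\<mu>)"

lemma depends_only_on_cond: "depends_only_on L (cond L f)"
  unfolding depends_only_on_def
proof (intro allI impI)
  fix x x' :: "'i \<Rightarrow> 'a" assume "\<forall>k\<in>L. x k = x' k"
  then have "override_on y x L = override_on y x' L" for y
    by (auto simp: override_on_def)
  then show "cond L f x = cond L f x'" by (simp add: cond_def)
qed

lemma integrable_override_on:
  fixes f :: "('i \<Rightarrow> 'a) \<Rightarrow> real"
  assumes "integrable \<mu> f"
  shows "integrable (\<mu> \<Otimes>\<^sub>M \<mu>) (\<lambda>p. f (override_on (snd p) (fst p) L))"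
  using assms by (intro integrable_distr[of "\<lambda>p. override_on (snd p) (fst p) L" _ \<mu> f])
    (simp_all add: distr_override_on)

lemma AE_integrable_override_on:
  fixes f :: "('i \<Rightarrow> 'a) \<Rightarrow> real"
  assumes "integrable \<mu> f"
  shows "AE x in \<mu>. integrable \<mu> (\<lambda>y. f (override_on y x L))"
  using pair.AE_integrable_fst'[OF integrable_override_on[OF assms]] by simp

lemma integrable_cond:
  assumes "integrable \<mu> f"
  shows "integrable \<mu> (cond L f)"
  using pair.integrable_fst'[OF integrable_override_on[OF assms]] by (simp add: cond_def[abs_def])

lemma integral_cond:
  assumes "integrable \<mu> f"
  shows "(\<integral>x. cond L f x \<partial>\<mu>) = (\<integral>x. f x \<partial>\<mu>)"
proof -
  have "(\<integral>x. cond L f x \<partial>\<mu>) = (\<integral>p. f (override_on (snd p) (fst p) L) \<partial>(\<mu> \<Otimes>\<^sub>M \<mu>))"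
    using pair.integral_fst'[OF integrable_override_on[OF assms]]
    by (simp add: cond_def[abs_def])
  also have "\<dots> = (\<integral>x. f x \<partial>distr (\<mu> \<Otimes>\<^sub>M \<mu>) \<mu> (\<lambda>p. override_on (snd p) (fst p) L))"
    using assms by (intro integral_distr[symmetric]) auto
  finally show ?thesis by (simp add: distr_override_on)
qed

lemma cond_mult:
  assumes "depends_only_on L g"
  shows "cond L (\<lambda>x. g x * f x) x = g x * cond L f x"
  using assms by (simp add: cond_def depends_only_on_override_on)

text \<open>Jensen's inequality on almost every section, in the form that a variance is
  nonnegative.\<close>

lemma L2_cond:
  assumes "f \<in> L2 \<mu>"
  shows "cond L f \<in> L2 \<mu>"
proof -
  have f: "integrable \<mu> f" and f2: "integrable \<mu> (\<lambda>x. (f x)\<^sup>2)"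
    using assms by (rule P.L2_integrable, rule L2_integrable_square)
  have [measurable]: "cond L f \<in> borel_measurable \<mu>"
    using integrable_cond[OF f] by simp
  have "AE x in \<mu>. (cond L f x)\<^sup>2 \<le> cond L (\<lambda>x. (f x)\<^sup>2) x"
    using AE_integrable_override_on[OF f, of L] AE_integrable_override_on[OF f2, of L]
    by eventually_elim (auto simp: cond_def intro!: P.expectation_square_le)
  then have "integrable \<mu> (\<lambda>x. (cond L f x)\<^sup>2)"
    by (intro Bochner_Integration.integrable_bound[OF integrable_cond[OF f2, of L]]) auto
  then show ?thesis
    by (simp add: L2_def)
qed

text \<open>Resampling outside \<open>K\<close> after resampling outside \<open>L\<close> keeps
  exactly the coordinates of \<open>x\<close> in \<open>L \<inter> K\<close>. The remaining double
  average is that of a single section of \<open>f\<close>, so \<open>integral_cond\<close> collapses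
  it wherever this section is integrable.\<close>

lemma cond_cond:
  assumes f: "integrable \<mu> f"
  shows "AE x in \<mu>. cond L (cond K f) x = cond (L \<inter> K) f x"
  using AE_integrable_override_on[OF f, of "L \<inter> K"]
proof eventually_elim
  fix x assume x: "integrable \<mu> (\<lambda>y. f (override_on y x (L \<inter> K)))"
  have "override_on z (override_on y x L) K = override_on (override_on z y K) x (L \<inter> K)" for y z
    by (auto simp: override_on_def)
  then have "cond L (cond K f) x = (\<integral>y. cond K (\<lambda>y. f (override_on y x (L \<inter> K))) y \<partial>\<mu>)"
    by (simp add: cond_def)
  also have "\<dots> = cond (L \<inter> K) f x"
    using integral_cond[OF x] by (simp add: cond_def)
  finally show "cond L (cond K f) x = cond (L \<inter> K) f x" .
qed

text \<open>Self-adjointness: the right-hand side below is symmetric in \<open>f\<close> and \<open>g\<close>.\<close>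

lemma integral_cond_mult_cond:
  assumes "f \<in> L2 \<mu>" "g \<in> L2 \<mu>"
  shows "(\<integral>x. cond L f x * g x \<partial>\<mu>) = (\<integral>x. cond L f x * cond L g x \<partial>\<mu>)"
proof -
  have "(\<integral>x. cond L f x * g x \<partial>\<mu>) = (\<integral>x. cond L (\<lambda>x. cond L f x * g x) x \<partial>\<mu>)"
    using assms by (intro integral_cond[symmetric] L2_integrable_mult L2_cond)
  moreover have "cond L (\<lambda>x. cond L f x * g x) x = cond L f x * cond L g x" for x
    by (rule cond_mult) (rule depends_only_on_cond)
  ultimately show ?thesis by simp
qed

text \<open>Moves both averages onto one factor, so that the dependence on \<open>L\<close> and
  \<open>K\<close> is through \<open>L \<inter> K\<close> only, the form required by
  \<open>mobius_mobius_Int\<close>.\<close>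

lemma integral_cond_cond:
  assumes f: "f \<in> L2 \<mu>" and g: "g \<in> L2 \<mu>"
  shows "(\<integral>x. cond L f x * cond K g x \<partial>\<mu>) = (\<integral>x. f x * cond (L \<inter> K) g x \<partial>\<mu>)"
proof -
  have g': "integrable \<mu> g" using g by (rule P.L2_integrable)
  have "(\<integral>x. cond L f x * cond K g x \<partial>\<mu>) = (\<integral>x. cond L f x * cond L (cond K g) x \<partial>\<mu>)"
    using f g by (intro integral_cond_mult_cond L2_cond)
  also have "\<dots> = (\<integral>x. cond L (cond K g) x * f x \<partial>\<mu>)"
    using f g integral_cond_mult_cond[of "cond K g" f L] integral_cond_mult_cond[of f "cond K g" L]
    by (simp add: L2_cond mult.commute[of "cond L f _"])
  also have "\<dots> = (\<integral>x. f x * cond (L \<inter> K) g x \<partial>\<mu>)"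
  proof (rule integral_cong_AE)
    show "AE x in \<mu>. cond L (cond K g) x * f x = f x * cond (L \<inter> K) g x"
      using cond_cond[OF g', of L K] by eventually_elim simp
    show "(\<lambda>x. cond L (cond K g) x * f x) \<in> borel_measurable \<mu>"
      "(\<lambda>x. f x * cond (L \<inter> K) g x) \<in> borel_measurable \<mu>"
      using L2_cond[OF f] L2_cond[OF g] L2_cond[OF L2_cond[OF g]] f g by measurable
  qed
  finally show ?thesis .
qed

lemma integral_mult_cond:
  assumes "f \<in> L2 \<mu>"
  shows "(\<integral>x. f x * cond L f x \<partial>\<mu>) = (\<integral>x. (cond L f x)\<^sup>2 \<partial>\<mu>)"
  using integral_cond_mult_cond[OF assms assms, of L] by (simp add: power2_eq_square mult.commute)

lemma integral_diff_cond_square: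
  assumes f: "f \<in> L2 \<mu>"
  shows "(\<integral>x. (f x - cond L f x)\<^sup>2 \<partial>\<mu>) = (\<integral>x. (f x)\<^sup>2 \<partial>\<mu>) - (\<integral>x. f x * cond L f x \<partial>\<mu>)"
proof -
  note int = L2_integrable_square[OF f] L2_integrable_square[OF L2_cond[OF f, of L]]
    L2_integrable_mult[OF f L2_cond[OF f, of L]]
  have "(\<integral>x. (f x - cond L f x)\<^sup>2 \<partial>\<mu>) =
      (\<integral>x. ((f x)\<^sup>2 + (cond L f x)\<^sup>2) - 2 * (f x * cond L f x) \<partial>\<mu>)"
    by (simp add: power2_diff mult.assoc)
  also have "\<dots> = ((\<integral>x. (f x)\<^sup>2 \<partial>\<mu>) + (\<integral>x. (cond L f x)\<^sup>2 \<partial>\<mu>)) - 2 * (\<integral>x. f x * cond L f x \<partial>\<mu>)"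
    using int by (subst Bochner_Integration.integral_diff) simp_all
  finally show ?thesis
    using integral_mult_cond[OF f, of L] by simp
qed

lemma AE_cond_diff:
  assumes "integrable \<mu> f" "integrable \<mu> g"
  shows "AE x in \<mu>. cond L (\<lambda>x. f x - g x) x = cond L f x - cond L g x"
  using AE_integrable_override_on[OF assms(1), of L] AE_integrable_override_on[OF assms(2), of L]
  by eventually_elim (simp add: cond_def)

lemma cond_eq_self:
  assumes "depends_only_on L g"
  shows "cond L g = g"
  using assms by (simp add: cond_def fun_eq_iff depends_only_on_override_on P.prob_space)

text \<open>Best approximation: \<open>cond L\<close> fixes \<open>g\<close>, so
  \<open>f - cond L f\<close> equals \<open>h - cond L h\<close> for \<open>h = f - g\<close>, and
  subtracting the projection does not increase the norm.\<close>

lemma integral_diff_cond_le: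
  assumes f: "f \<in> L2 \<mu>" and g: "g \<in> L2 \<mu>"
    and local: "depends_only_on L g"
  shows "(\<integral>x. (f x - cond L f x)\<^sup>2 \<partial>\<mu>) \<le> (\<integral>x. (f x - g x)\<^sup>2 \<partial>\<mu>)"
proof -
  let ?h = "\<lambda>x. f x - g x"
  have h: "?h \<in> L2 \<mu>" using f g by (rule L2_diff)
  note [measurable] = L2_cond[OF f, of L] L2_cond[OF h, of L] f g
  have "AE x in \<mu>. cond L ?h x = cond L f x - g x"
    using AE_cond_diff[OF P.L2_integrable[OF f] P.L2_integrable[OF g], of L]
      cond_eq_self[OF local] by simp
  then have "(\<integral>x. (f x - cond L f x)\<^sup>2 \<partial>\<mu>) = (\<integral>x. (?h x - cond L ?h x)\<^sup>2 \<partial>\<mu>)"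
    by (intro integral_cong_AE) auto
  also have "\<dots> \<le> (\<integral>x. (?h x)\<^sup>2 \<partial>\<mu>)"
    using integral_diff_cond_square[OF h, of L] integral_mult_cond[OF h, of L] by simp
  finally show ?thesis .
qed

section \<open>Density of the functions of finitely many coordinates\<close>

text \<open>The approximant is left arbitrary, which makes closure under sums and limits easy. Only
  at the end is it exchanged for \<open>cond N f\<close>, by best approximation.\<close>

definition approximable :: "(('i \<Rightarrow> 'a) \<Rightarrow> real) \<Rightarrow> bool" where
  "approximable f \<longleftrightarrow> f \<in> L2 \<mu> \<and>
     (\<forall>\<epsilon>>0. \<exists>N g. finite N \<and> g \<in> L2 \<mu> \<and> depends_only_on N g \<and>
        (\<integral>x. (f x - g x)\<^sup>2 \<partial>\<mu>) < \<epsilon>)"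

lemma approximableE:
  assumes "approximable f" "\<epsilon> > 0"
  obtains N g where "finite N" "g \<in> L2 \<mu>" "depends_only_on N g"
    "(\<integral>x. (f x - g x)\<^sup>2 \<partial>\<mu>) < \<epsilon>"
  using assms unfolding approximable_def by blast

lemma approximable_L2: "approximable f \<Longrightarrow> f \<in> L2 \<mu>"
  by (simp add: approximable_def)

lemma approximable_add:
  assumes f: "approximable f" and g: "approximable g"
  shows "approximable (\<lambda>x. f x + g x)"
  unfolding approximable_def
proof (intro conjI allI impI)
  show "(\<lambda>x. f x + g x) \<in> L2 \<mu>"
    using f g by (intro L2_add approximable_L2)
  fix \<epsilon> :: real assume "\<epsilon> > 0"
  then have "\<epsilon> / 4 > 0" by simp
  obtain N u where u: "finite N" "u \<in> L2 \<mu>" "depends_only_on N u"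
      "(\<integral>x. (f x - u x)\<^sup>2 \<partial>\<mu>) < \<epsilon> / 4"
    by (rule approximableE[OF f \<open>\<epsilon> / 4 > 0\<close>])
  obtain K v where v: "finite K" "v \<in> L2 \<mu>" "depends_only_on K v"
      "(\<integral>x. (g x - v x)\<^sup>2 \<partial>\<mu>) < \<epsilon> / 4"
    by (rule approximableE[OF g \<open>\<epsilon> / 4 > 0\<close>])
  have "(\<integral>x. (f x + g x - (u x + v x))\<^sup>2 \<partial>\<mu>) = (\<integral>x. ((f x - u x) + (g x - v x))\<^sup>2 \<partial>\<mu>)"
    by (simp add: algebra_simps)
  also have "\<dots> \<le> 2 * (\<integral>x. (f x - u x)\<^sup>2 \<partial>\<mu>) + 2 * (\<integral>x. (g x - v x)\<^sup>2 \<partial>\<mu>)"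
    using u v by (intro integral_add_square_le L2_diff f[THEN approximable_L2] g[THEN approximable_L2])
  also have "\<dots> < \<epsilon>"
    using u v by simp
  finally have "(\<integral>x. (f x + g x - (u x + v x))\<^sup>2 \<partial>\<mu>) < \<epsilon>" .
  moreover have "depends_only_on (N \<union> K) (\<lambda>x. u x + v x)"
    using u(3) v(3) unfolding depends_only_on_def by (metis UnCI)
  ultimately show "\<exists>N g'. finite N \<and> g' \<in> L2 \<mu> \<and> depends_only_on N g' \<and>
        (\<integral>x. (f x + g x - g' x)\<^sup>2 \<partial>\<mu>) < \<epsilon>"
    using u v by (intro exI[of _ "N \<union> K"] exI[of _ "\<lambda>x. u x + v x"] conjI L2_add) auto
qed

lemma approximable_limit:
  assumes f: "f \<in> L2 \<mu>" and U: "\<And>i. approximable (U i)"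
    and lim: "(\<lambda>i. \<integral>x. (f x - U i x)\<^sup>2 \<partial>\<mu>) \<longlonglongrightarrow> 0"
  shows "approximable f"
  unfolding approximable_def
proof (intro conjI allI impI f)
  fix \<epsilon> :: real assume "\<epsilon> > 0"
  then have "\<epsilon> / 4 > 0" by simp
  with lim have "eventually (\<lambda>i. (\<integral>x. (f x - U i x)\<^sup>2 \<partial>\<mu>) < \<epsilon> / 4) sequentially"
    by (rule order_tendstoD)
  then obtain i where i: "(\<integral>x. (f x - U i x)\<^sup>2 \<partial>\<mu>) < \<epsilon> / 4"
    using eventually_happens'[OF sequentially_bot] by blast
  obtain N u where u: "finite N" "u \<in> L2 \<mu>" "depends_only_on N u"
      "(\<integral>x. (U i x - u x)\<^sup>2 \<partial>\<mu>) < \<epsilon> / 4"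
    by (rule approximableE[OF U[of i] \<open>\<epsilon> / 4 > 0\<close>])
  have "(\<integral>x. (f x - u x)\<^sup>2 \<partial>\<mu>) = (\<integral>x. ((f x - U i x) + (U i x - u x))\<^sup>2 \<partial>\<mu>)"
    by simp
  also have "\<dots> \<le> 2 * (\<integral>x. (f x - U i x)\<^sup>2 \<partial>\<mu>) + 2 * (\<integral>x. (U i x - u x)\<^sup>2 \<partial>\<mu>)"
    using u by (intro integral_add_square_le L2_diff f U[THEN approximable_L2])
  also have "\<dots> < \<epsilon>"
    using u i by simp
  finally show "\<exists>N g. finite N \<and> g \<in> L2 \<mu> \<and> depends_only_on N g \<and>
        (\<integral>x. (f x - g x)\<^sup>2 \<partial>\<mu>) < \<epsilon>"
    using u by blast
qed

lemma approximable_local: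
  assumes "finite N" "g \<in> L2 \<mu>" "depends_only_on N g"
    and f: "\<And>x. x \<in> space \<mu> \<Longrightarrow> f x = g x"
  shows "approximable f"
  unfolding approximable_def
proof (intro conjI allI impI)
  show "f \<in> L2 \<mu>" using L2_cong[of \<mu> f g] f assms(2) by simp
  fix \<epsilon> :: real assume "\<epsilon> > 0"
  moreover have "(\<integral>x. (f x - g x)\<^sup>2 \<partial>\<mu>) = (\<integral>x. 0 \<partial>\<mu>)"
    using f by (intro Bochner_Integration.integral_cong) auto
  ultimately show "\<exists>N g. finite N \<and> g \<in> L2 \<mu> \<and> depends_only_on N g \<and>
        (\<integral>x. (f x - g x)\<^sup>2 \<partial>\<mu>) < \<epsilon>"
    using assms(1-3) by (intro exI[of _ N] exI[of _ g]) auto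
qed

lemma approximable_const: "approximable (\<lambda>_. c)"
  by (rule approximable_local[of "{}" "\<lambda>_. c"]) (auto simp: L2_def depends_only_on_def)

lemma approximable_cmult:
  assumes f: "approximable f"
  shows "approximable (\<lambda>x. c * f x)"
proof (cases "c = 0")
  case True
  then show ?thesis using approximable_const[of 0] by simp
next
  case False
  show ?thesis
    unfolding approximable_def
  proof (intro conjI allI impI L2_cmult approximable_L2 f)
    fix \<epsilon> :: real assume "\<epsilon> > 0"
    then have "\<epsilon> / c\<^sup>2 > 0" using False by simp
    obtain N u where u: "finite N" "u \<in> L2 \<mu>" "depends_only_on N u"
        "(\<integral>x. (f x - u x)\<^sup>2 \<partial>\<mu>) < \<epsilon> / c\<^sup>2"
      by (rule approximableE[OF f \<open>\<epsilon> / c\<^sup>2 > 0\<close>])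
    have "(\<integral>x. (c * f x - c * u x)\<^sup>2 \<partial>\<mu>) = c\<^sup>2 * (\<integral>x. (f x - u x)\<^sup>2 \<partial>\<mu>)"
      by (simp flip: right_diff_distrib add: power_mult_distrib)
    also have "\<dots> < \<epsilon>"
      using u(4) False by (simp add: field_simps)
    finally have "(\<integral>x. (c * f x - c * u x)\<^sup>2 \<partial>\<mu>) < \<epsilon>" .
    moreover have "depends_only_on N (\<lambda>x. c * u x)"
      using u(3) unfolding depends_only_on_def by metis
    ultimately show "\<exists>N g. finite N \<and> g \<in> L2 \<mu> \<and> depends_only_on N g \<and>
        (\<integral>x. (c * f x - g x)\<^sup>2 \<partial>\<mu>) < \<epsilon>"
      using u(1) L2_cmult[OF u(2), of c] by blast
  qed
qed

lemma approximable_sum: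
  assumes "\<And>i. i \<in> I \<Longrightarrow> approximable (f i)"
  shows "approximable (\<lambda>x. \<Sum>i\<in>I. f i x)"
  using assms
proof (induction I rule: infinite_finite_induct)
  case (insert i I)
  then show ?case using approximable_add[of "f i"] by simp
qed (auto simp: approximable_const)

lemma approximable_prod_emb:
  assumes J: "finite J" and F: "\<And>j. j \<in> J \<Longrightarrow> F j \<in> sets (E j)"
  shows "approximable (indicator (prod_emb UNIV E J (Pi\<^sub>E J F)))"
proof (rule approximable_local[OF J, of "indicator {x. \<forall>j\<in>J. x j \<in> F j}"])
  let ?A = "prod_emb UNIV E J (Pi\<^sub>E J F)"
  have eq: "indicator ?A x = (indicator {x. \<forall>j\<in>J. x j \<in> F j} x :: real)" if "x \<in> space \<mu>" for x
    using that by (auto simp: prod_emb_def space_PiM indicator_def)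
  have "(indicator ?A :: _ \<Rightarrow> real) \<in> L2 \<mu>"
    using J F by (intro P.L2_indicator sets_PiM_I) auto
  then show "(indicator {x. \<forall>j\<in>J. x j \<in> F j} :: _ \<Rightarrow> real) \<in> L2 \<mu>"
    using L2_cong[of \<mu> "indicator ?A" "indicator {x. \<forall>j\<in>J. x j \<in> F j}"] eq by blast
  show "indicator ?A x = (indicator {x. \<forall>j\<in>J. x j \<in> F j} x :: real)" if "x \<in> space \<mu>" for x
    using that by (rule eq)
qed (auto simp: indicator_def depends_only_on_def)

text \<open>A Dynkin class argument over the intersection-stable generator of cylinders.\<close>

lemma approximable_indicator:
  assumes "A \<in> sets \<mu>"
  shows "approximable (indicator A)"
proof -
  have "A \<in> sigma_sets (\<Pi>\<^sub>E i\<in>UNIV. space (E i)) (prod_algebra UNIV E)"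
    using assms by (simp add: sets_PiM)
  with Int_stable_prod_algebra prod_algebra_sets_into_space show ?thesis
  proof (induction A rule: sigma_sets_induct_disjoint)
    case (basic A)
    then show ?case
      by (auto elim!: prod_algebraE intro: approximable_prod_emb)
  next
    case empty
    then show ?case using approximable_const[of 0] by (simp add: indicator_def[abs_def])
  next
    case (compl A)
    then have A: "A \<in> sets \<mu>" by (simp add: sets_PiM)
    have eq: "(\<Pi>\<^sub>E i\<in>UNIV. space (E i)) - A = space \<mu> - A" by (simp add: space_PiM)
    have "approximable (\<lambda>x. 1 + (- 1) * indicator A x)"
      by (intro approximable_add approximable_const approximable_cmult compl)
    then have *: "approximable (\<lambda>x. 1 - indicator A x)" by simp
    show ?case
      unfolding eq
    \<comment> \<open>A constant sequence suffices: \<open>1 - indicator A\<close> and the indicator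
      of the complement agree on the space, hence have distance 0, but may differ off it.\<close>
    proof (rule approximable_limit[OF _ *])
      show "(indicator (space \<mu> - A) :: _ \<Rightarrow> real) \<in> L2 \<mu>"
        using A by (intro P.L2_indicator) auto
      have "(\<integral>x. (indicator (space \<mu> - A) x - (1 - indicator A x :: real))\<^sup>2 \<partial>\<mu>) = (\<integral>x. 0 \<partial>\<mu>)"
        by (intro Bochner_Integration.integral_cong) (auto simp: indicator_def)
      then show "(\<lambda>i. (\<integral>x. (indicator (space \<mu> - A) x - (1 - indicator A x :: real))\<^sup>2 \<partial>\<mu>)) \<longlonglongrightarrow> 0"
        by simp
    qed
  next
    case (union A)
    then have A: "A i \<in> sets \<mu>" for i by (auto simp: sets_PiM)
    let ?U = "\<lambda>n x. \<Sum>i<n. indicator (A i) x :: real"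
    have U: "?U n = indicator (\<Union>i<n. A i)" for n
      using union.hyps(1)
      by (auto simp: fun_eq_iff indicator_UN_disjoint disjoint_family_on_def)
    have L2: "(indicator (\<Union>i. A i) :: _ \<Rightarrow> real) \<in> L2 \<mu>"
      using A by (intro P.L2_indicator) auto
    show ?case
    proof (rule approximable_limit[OF L2, of ?U])
      show "approximable (?U n)" for n
        by (intro approximable_sum union)
      show "(\<lambda>n. \<integral>x. (indicator (\<Union>i. A i) x - ?U n x)\<^sup>2 \<partial>\<mu>) \<longlonglongrightarrow> 0"
      proof (rule L2_dominated_convergence(2)[OF L2])
        show "?U n \<in> borel_measurable \<mu>" for n using A by simp
        show "\<bar>?U n x\<bar> \<le> \<bar>indicator (\<Union>i. A i) x\<bar>" for n x
          unfolding fun_cong[OF U] by (auto simp: indicator_def)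
        show "(\<lambda>n. ?U n x) \<longlonglongrightarrow> indicator (\<Union>i. A i) x" for x
          unfolding fun_cong[OF U] by (rule LIMSEQ_indicator_UN)
      qed
    qed
  qed
qed

text \<open>Square integrability is a premise of the induction and is inherited by the parts:
  nonnegative summands and members of an increasing sequence are dominated by the whole.\<close>

lemma approximable_nonneg:
  assumes "f \<in> borel_measurable \<mu>" "\<And>x. 0 \<le> f x" "integrable \<mu> (\<lambda>x. (f x)\<^sup>2)"
  shows "approximable f"
  using assms
proof (induction rule: borel_measurable_induct_real)
  case (set A)
  then show ?case by (simp add: approximable_indicator)
next
  case (mult u c)
  show ?case
  \<comment> \<open>For \<open>c = 0\<close>, integrability of the square of \<open>c * u\<close>
    says nothing about \<open>u\<close>.\<close>
  proof (cases "c = 0")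
    case True
    then show ?thesis using approximable_const[of 0] by simp
  next
    case False
    with mult.prems have "integrable \<mu> (\<lambda>x. (u x)\<^sup>2)" by (simp add: power_mult_distrib)
    with mult show ?thesis by (intro approximable_cmult) auto
  qed
next
  case (add u v)
  have "(u x)\<^sup>2 \<le> (v x + u x)\<^sup>2" "(v x)\<^sup>2 \<le> (v x + u x)\<^sup>2" for x
    using add.hyps(2,4)[of x] by (auto intro!: power_mono)
  then have "integrable \<mu> (\<lambda>x. (u x)\<^sup>2)" "integrable \<mu> (\<lambda>x. (v x)\<^sup>2)"
    using add.hyps by (auto intro!: Bochner_Integration.integrable_bound[OF add.prems])
  with add show ?case by (intro approximable_add) auto
next
  case (seq U)
  have f: "f \<in> L2 \<mu>" using assms(1) seq.prems by (simp add: L2_def)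
  have "U i x \<le> f x" if "x \<in> space \<mu>" for i x
    using seq.hyps(3) seq.hyps(4)[OF that] by (intro incseq_le) (auto simp: incseq_def le_fun_def)
  with seq.hyps(2) have le: "\<bar>U i x\<bar> \<le> \<bar>f x\<bar>" if "x \<in> space \<mu>" for i x
    using that abs_le_iff by (smt (verit))
  note dom = L2_dominated_convergence[OF f seq.hyps(1) le seq.hyps(4)]
  show ?case
  proof (rule approximable_limit[OF f _ dom(2)])
    show "approximable (U i)" for i
      using dom(1)[of i] seq.IH by (simp add: L2_def)
  qed
qed

lemma approximable:
  assumes f: "f \<in> L2 \<mu>"
  shows "approximable f"
proof -
  have [measurable]: "f \<in> borel_measurable \<mu>" using f by simp
  have "approximable (\<lambda>x. max 0 (f x))" "approximable (\<lambda>x. max 0 (- f x))"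
    by (intro approximable_nonneg Bochner_Integration.integrable_bound[OF L2_integrable_square[OF f]];
      auto simp: max_def)+
  then have "approximable (\<lambda>x. max 0 (f x) + (- 1) * max 0 (- f x))"
    by (intro approximable_add approximable_cmult)
  moreover have "(\<lambda>x. max 0 (f x) + (- 1) * max 0 (- f x)) = f"
    by (auto simp: max_def)
  ultimately show ?thesis by simp
qed

lemma cond_approximation:
  assumes f: "f \<in> L2 \<mu>" and "\<epsilon> > 0"
  obtains N where "finite N" "(\<integral>x. (f x - cond N f x)\<^sup>2 \<partial>\<mu>) < \<epsilon>"
proof -
  obtain N g where g: "finite N" "g \<in> L2 \<mu>"
      "depends_only_on N g"
      "(\<integral>x. (f x - g x)\<^sup>2 \<partial>\<mu>) < \<epsilon>"
    by (rule approximableE[OF approximable[OF f] \<open>\<epsilon> > 0\<close>])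
  have "(\<integral>x. (f x - cond N f x)\<^sup>2 \<partial>\<mu>) < \<epsilon>"
    using integral_diff_cond_le[OF f g(2,3)] g(4) by fastforce
  with g(1) show thesis by (rule that)
qed

section \<open>The Hoeffding decomposition on a product space\<close>

definition hoeffding :: "'i set \<Rightarrow> (('i \<Rightarrow> 'a) \<Rightarrow> real) \<Rightarrow> ('i \<Rightarrow> 'a) \<Rightarrow> real" where
  "hoeffding K f x = mobius (\<lambda>L. cond L f x) K"

lemma sum_hoeffding: "finite N \<Longrightarrow> (\<Sum>K\<in>Pow N. hoeffding K f x) = cond N f x"
  unfolding hoeffding_def by (rule sum_mobius)

lemma L2_hoeffding: "f \<in> L2 \<mu> \<Longrightarrow> hoeffding K f \<in> L2 \<mu>"
  unfolding hoeffding_def[abs_def] mobius_def by (intro L2_sum_mem L2_cmult L2_cond)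

lemma integral_mult_hoeffding:
  assumes f: "f \<in> L2 \<mu>" and g: "g \<in> L2 \<mu>"
  shows "(\<integral>x. g x * hoeffding K f x \<partial>\<mu>) = mobius (\<lambda>L. \<integral>x. g x * cond L f x \<partial>\<mu>) K"
proof -
  have "(\<integral>x. g x * hoeffding K f x \<partial>\<mu>) =
      (\<integral>x. (\<Sum>L\<in>Pow K. (- 1) ^ (card K - card L) * (g x * cond L f x)) \<partial>\<mu>)"
    by (simp add: hoeffding_def mobius_def sum_distrib_left mult_ac)
  also have "\<dots> = mobius (\<lambda>L. \<integral>x. g x * cond L f x \<partial>\<mu>) K"
    unfolding mobius_def
    by (subst Bochner_Integration.integral_sum) (auto intro!: L2_integrable_mult L2_cond f g)
  finally show ?thesis .
qed

text \<open>Expanding both factors leaves a double alternating sum of a function of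
  \<open>B \<inter> A\<close>. The diagonal value is written as an inner product with
  \<open>f\<close>, not as a squared norm, because that form is linear in the term and can be summed
  by Moebius inversion.\<close>

lemma integral_hoeffding_mult:
  assumes f: "f \<in> L2 \<mu>" and "finite K" "finite L"
  shows "(\<integral>x. hoeffding K f x * hoeffding L f x \<partial>\<mu>) =
      (if K = L then (\<integral>x. f x * hoeffding K f x \<partial>\<mu>) else 0)"
proof -
  have "(\<integral>x. hoeffding K f x * hoeffding L f x \<partial>\<mu>) =
      mobius (\<lambda>B. \<integral>x. cond B f x * hoeffding K f x \<partial>\<mu>) L"
    using integral_mult_hoeffding[OF f L2_hoeffding[OF f]] by (simp add: mult.commute)
  also have "\<dots> = mobius (\<lambda>B. mobius (\<lambda>A. \<integral>x. f x * cond (B \<inter> A) f x \<partial>\<mu>) K) L"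
    using f by (simp add: integral_mult_hoeffding L2_cond integral_cond_cond)
  also have "\<dots> = (if K = L then (\<integral>x. f x * hoeffding K f x \<partial>\<mu>) else 0)"
    unfolding mobius_mobius_Int[of L K "\<lambda>A. \<integral>x. f x * cond A f x \<partial>\<mu>", OF assms(3,2)]
    by (simp add: integral_mult_hoeffding[OF f f])
  finally show ?thesis .
qed

lemma integral_mult_hoeffding_nonneg:
  assumes "f \<in> L2 \<mu>" "finite K"
  shows "0 \<le> (\<integral>x. f x * hoeffding K f x \<partial>\<mu>)"
proof -
  have "(\<integral>x. f x * hoeffding K f x \<partial>\<mu>) = (\<integral>x. (hoeffding K f x)\<^sup>2 \<partial>\<mu>)"
    using integral_hoeffding_mult[OF assms assms(2)] by (simp add: power2_eq_square)
  then show ?thesis by simp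
qed

lemma integral_sum_hoeffding_square:
  assumes f: "f \<in> L2 \<mu>" and S: "finite S" "\<And>K. K \<in> S \<Longrightarrow> finite K"
  shows "(\<integral>x. (\<Sum>K\<in>S. c K * hoeffding K f x)\<^sup>2 \<partial>\<mu>) =
      (\<Sum>K\<in>S. (c K)\<^sup>2 * (\<integral>x. f x * hoeffding K f x \<partial>\<mu>))"
proof -
  have int: "integrable \<mu> (\<lambda>x. hoeffding K f x * hoeffding L f x)" for K L
    by (intro L2_integrable_mult L2_hoeffding f)
  have "(\<integral>x. (\<Sum>K\<in>S. c K * hoeffding K f x)\<^sup>2 \<partial>\<mu>) =
      (\<integral>x. (\<Sum>K\<in>S. \<Sum>L\<in>S. (c K * c L) * (hoeffding K f x * hoeffding L f x)) \<partial>\<mu>)"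
    by (simp add: power2_eq_square sum_product mult_ac)
  also have "\<dots> = (\<Sum>K\<in>S. \<Sum>L\<in>S. (c K * c L) * (\<integral>x. hoeffding K f x * hoeffding L f x \<partial>\<mu>))"
    using int by (simp add: Bochner_Integration.integral_sum)
  also have "\<dots> = (\<Sum>K\<in>S. \<Sum>L\<in>S. if K = L then (c K)\<^sup>2 * (\<integral>x. f x * hoeffding K f x \<partial>\<mu>) else 0)"
    using S by (intro sum.cong refl) (auto simp: integral_hoeffding_mult f power2_eq_square)
  finally show ?thesis
    using S by simp
qed

text \<open>Bessel's inequality: the inner product of \<open>f\<close> with the partial sum equals
  the squared norm of the partial sum, and the squared norm of the difference is
  nonnegative.\<close>

lemma sum_integral_mult_hoeffding_le:
  assumes f: "f \<in> L2 \<mu>" and S: "finite S" "\<And>K. K \<in> S \<Longrightarrow> finite K"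
  shows "(\<Sum>K\<in>S. \<integral>x. f x * hoeffding K f x \<partial>\<mu>) \<le> (\<integral>x. (f x)\<^sup>2 \<partial>\<mu>)"
proof -
  let ?s = "\<lambda>x. \<Sum>K\<in>S. hoeffding K f x"
  have s: "?s \<in> L2 \<mu>"
    by (intro L2_sum_mem L2_hoeffding f)
  have fs: "(\<integral>x. f x * ?s x \<partial>\<mu>) = (\<Sum>K\<in>S. \<integral>x. f x * hoeffding K f x \<partial>\<mu>)"
    unfolding sum_distrib_left
    by (intro Bochner_Integration.integral_sum L2_integrable_mult L2_hoeffding f)
  have ss: "(\<integral>x. (?s x)\<^sup>2 \<partial>\<mu>) = (\<Sum>K\<in>S. \<integral>x. f x * hoeffding K f x \<partial>\<mu>)"
    using integral_sum_hoeffding_square[OF f S, of "\<lambda>_. 1"] by simp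
  have "0 \<le> (\<integral>x. (f x - ?s x)\<^sup>2 \<partial>\<mu>)"
    by simp
  also have "\<dots> = (\<integral>x. ((f x)\<^sup>2 + (?s x)\<^sup>2) - 2 * (f x * ?s x) \<partial>\<mu>)"
    by (simp add: power2_diff mult.assoc)
  also have "\<dots> = ((\<integral>x. (f x)\<^sup>2 \<partial>\<mu>) + (\<integral>x. (?s x)\<^sup>2 \<partial>\<mu>)) - 2 * (\<integral>x. f x * ?s x \<partial>\<mu>)"
    using L2_integrable_square[OF f] L2_integrable_square[OF s] L2_integrable_mult[OF f s]
    by (subst Bochner_Integration.integral_diff) simp_all
  finally show ?thesis
    unfolding fs ss by simp
qed

text \<open>After orthogonality and \<open>\<bar>c K\<bar> \<le> 1\<close>, Bessel bounds the sum
  over \<open>S\<close> by the squared norm of \<open>f\<close>, and inversion evaluates the sum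
  over \<open>Pow N\<close>; the difference is the squared distance from \<open>f\<close> to
  \<open>cond N f\<close>. The bound is uniform in \<open>S\<close>, as convergence of the net
  demands.\<close>

lemma integral_sum_hoeffding_tail_le:
  assumes f: "f \<in> L2 \<mu>" and S: "finite S" "\<And>K. K \<in> S \<Longrightarrow> finite K" and N: "finite N" "Pow N \<subseteq> S"
    and c: "\<And>K. \<bar>c K\<bar> \<le> 1"
  shows "(\<integral>x. ((\<Sum>K\<in>S. c K * hoeffding K f x) - (\<Sum>K\<in>Pow N. c K * hoeffding K f x))\<^sup>2 \<partial>\<mu>)
      \<le> (\<integral>x. (f x - cond N f x)\<^sup>2 \<partial>\<mu>)"
proof -
  let ?d = "\<lambda>K. \<integral>x. f x * hoeffding K f x \<partial>\<mu>"
  have split: "(\<Sum>K\<in>S. h K) - (\<Sum>K\<in>Pow N. h K) = (\<Sum>K\<in>S - Pow N. h K)" for h :: "'i set \<Rightarrow> real"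
    using S N by (simp add: sum_diff)
  have "(\<integral>x. ((\<Sum>K\<in>S. c K * hoeffding K f x) - (\<Sum>K\<in>Pow N. c K * hoeffding K f x))\<^sup>2 \<partial>\<mu>) =
      (\<Sum>K\<in>S - Pow N. (c K)\<^sup>2 * ?d K)"
    unfolding split using S by (intro integral_sum_hoeffding_square f) auto
  also have "\<dots> \<le> (\<Sum>K\<in>S - Pow N. ?d K)"
  proof (rule sum_mono)
    fix K assume "K \<in> S - Pow N"
    then have "0 \<le> ?d K" using S by (intro integral_mult_hoeffding_nonneg f) auto
    moreover have "(c K)\<^sup>2 \<le> 1" using c[of K] by (simp add: abs_square_le_1)
    ultimately show "(c K)\<^sup>2 * ?d K \<le> ?d K"
      using mult_right_mono by fastforce
  qed
  also have "\<dots> = (\<Sum>K\<in>S. ?d K) - (\<Sum>K\<in>Pow N. ?d K)"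
    unfolding split ..
  also have "(\<Sum>K\<in>Pow N. ?d K) = (\<integral>x. f x * cond N f x \<partial>\<mu>)"
    using sum_mobius[OF N(1)] by (simp add: integral_mult_hoeffding[OF f f])
  also have "(\<Sum>K\<in>S. ?d K) - \<dots> \<le> (\<integral>x. (f x - cond N f x)\<^sup>2 \<partial>\<mu>)"
    using sum_integral_mult_hoeffding_le[OF f S] by (simp add: integral_diff_cond_square[OF f])
  finally show ?thesis .
qed

end

section \<open>Conditioning in the resampling setting\<close>

context resampling_setting
begin

sublocale base: full_product_prob_space E
  using prob_space_E by (intro full_product_prob_space.intro product_prob_space.intro
    product_prob_space_axioms.intro product_sigma_finite.intro prob_space_imp_sigma_finite) auto

abbreviation "\<mu> \<equiv> PiM UNIV E"
abbreviation "Xt t \<equiv> resampled X X' Z t"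
abbreviation "\<sigma>X \<equiv> sigma_seq M E X"
abbreviation "\<sigma>C L \<equiv> sigma_coords M E X L"

lemma measurable_X [measurable]: "X \<in> measurable M \<mu>" "X' \<in> measurable M \<mu>"
  by (fact X_measurable X'_measurable)+

lemma measurable_Z [measurable]: "Z k \<in> borel_measurable M"
  using distributed_measurable[OF Z_exponential[of k]] by simp

lemma measurable_component [measurable]: "(\<lambda>\<omega>. X \<omega> k) \<in> measurable M (E k)"
  using measurable_compose[OF X_measurable, of "\<lambda>x. x k"] by simp

lemma measurable_Xt [measurable]: "Xt t \<in> measurable M \<mu>"
proof -
  have "Xt t = (\<lambda>\<omega>. override_on (X' \<omega>) (X \<omega>) {k. Z k \<omega> > t})"
    by (simp add: resampled_def override_on_def fun_eq_iff)
  also have "\<dots> \<in> measurable M \<mu>"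
    by (intro measurable_override_on) measurable
  finally show ?thesis .
qed

lemma distr_transfer:
  fixes g :: "(nat \<Rightarrow> 'a) \<Rightarrow> real"
  assumes Y [measurable]: "Y \<in> measurable M \<mu>" and distr: "distr M \<mu> Y = \<mu>"
    and g [measurable]: "g \<in> borel_measurable \<mu>"
  shows "integrable M (\<lambda>\<omega>. g (Y \<omega>)) \<longleftrightarrow> integrable \<mu> g"
    and "(\<integral>\<omega>. g (Y \<omega>) \<partial>M) = (\<integral>x. g x \<partial>\<mu>)"
  using integrable_distr_eq[OF Y g] integral_distr[OF Y g] by (simp_all add: distr)

lemma L2_transfer:
  assumes Y [measurable]: "Y \<in> measurable M \<mu>" and distr: "distr M \<mu> Y = \<mu>" and g: "g \<in> L2 \<mu>"
  shows "(\<lambda>\<omega>. g (Y \<omega>)) \<in> L2 M"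
proof -
  have [measurable]: "g \<in> borel_measurable \<mu>" using g by simp
  show ?thesis
    using distr_transfer(1)[OF Y distr, of "\<lambda>x. (g x)\<^sup>2"] L2_integrable_square[OF g]
    by (simp add: L2_def)
qed

lemma sets_sigma_seq: "sets \<sigma>X = {X -` A \<inter> space M | A. A \<in> sets \<mu>}"
  unfolding sigma_seq_def
  by (rule sets_vimage_algebra2) (use measurable_space[OF X_measurable] in auto)

lemma subalgebra_sigma_seq: "subalgebra M \<sigma>X"
  using measurable_sets[OF X_measurable]
  by (auto simp: subalgebra_def sets_sigma_seq) (simp add: sigma_seq_def)+

lemma measurable_X_sigma_seq: "X \<in> measurable \<sigma>X \<mu>"
  unfolding sigma_seq_def
  by (rule measurable_vimage_algebra1) (use measurable_space[OF X_measurable] in auto)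

lemma sets_sigma_coords:
  "sets (\<sigma>C L) = sigma_sets (space M) (\<Union>j\<in>L. {(\<lambda>\<omega>. X \<omega> j) -` A \<inter> space M | A. A \<in> sets (E j)})"
  unfolding sigma_coords_def by (rule sets_measure_of) auto

lemma space_sigma_coords: "space (\<sigma>C L) = space M"
  unfolding sigma_coords_def by (rule space_measure_of) auto

lemma subalgebra_sigma_coords: "subalgebra M (\<sigma>C L)"
proof -
  have "sets (\<sigma>C L) \<subseteq> sets M"
    unfolding sets_sigma_coords
    by (rule sets.sigma_sets_subset) (auto intro: measurable_sets[OF measurable_component])
  then show ?thesis by (simp add: subalgebra_def space_sigma_coords)
qed

sublocale seq: finite_measure_subalgebra M \<sigma>X
  by unfold_locales (rule subalgebra_sigma_seq)

sublocale coords: finite_measure_subalgebra M "\<sigma>C L" for L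
  by unfold_locales (rule subalgebra_sigma_coords)

text \<open>
  Filling the coordinates outside \<open>L\<close> with a fixed point \<open>p\<close> makes \<open>\<F>\<^sub>L\<close> the sigma-algebra
  generated by a single map into the full product.
\<close>

lemma measurable_fill_sigma_coords:
  assumes p: "p \<in> space \<mu>"
  shows "(\<lambda>\<omega>. override_on p (X \<omega>) L) \<in> measurable (\<sigma>C L) \<mu>"
proof (rule measurable_PiM_single')
  fix k
  show "(\<lambda>\<omega>. override_on p (X \<omega>) L k) \<in> measurable (\<sigma>C L) (E k)"
  proof (cases "k \<in> L")
    case True
    have "(\<lambda>\<omega>. X \<omega> k) \<in> measurable (\<sigma>C L) (E k)"
    proof (rule measurableI)
      show "X \<omega> k \<in> space (E k)" if "\<omega> \<in> space (\<sigma>C L)" for \<omega>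
        using that measurable_space[OF measurable_component] by (simp add: space_sigma_coords)
      show "(\<lambda>\<omega>. X \<omega> k) -` A \<inter> space (\<sigma>C L) \<in> sets (\<sigma>C L)" if "A \<in> sets (E k)" for A
        unfolding sets_sigma_coords space_sigma_coords
        using that True by (intro sigma_sets.Basic) auto
    qed
    then show ?thesis using True by (simp add: override_on_def)
  next
    case False
    then show ?thesis using p by (auto simp: override_on_def space_PiM intro!: measurable_const dest: PiE_mem)
  qed
next
  show "(\<lambda>\<omega>. override_on p (X \<omega>) L) \<in> space (\<sigma>C L) \<rightarrow> (\<Pi>\<^sub>E i\<in>UNIV. space (E i))"
    using p base.override_on_in_space[OF measurable_space[OF X_measurable] p]
    by (auto simp: space_sigma_coords space_PiM)
qed

lemma sigma_coordsE:
  assumes p: "p \<in> space \<mu>" and A: "A \<in> sets (\<sigma>C L)"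
  obtains B where "B \<in> sets \<mu>" "A = (\<lambda>\<omega>. override_on p (X \<omega>) L) -` B \<inter> space M"
proof -
  let ?\<rho> = "\<lambda>\<omega>. override_on p (X \<omega>) L"
  have \<rho>: "?\<rho> \<in> space M \<rightarrow> space \<mu>"
    using base.override_on_in_space[OF measurable_space[OF X_measurable] p] by auto
  have "sets (\<sigma>C L) \<subseteq> sets (vimage_algebra (space M) ?\<rho> \<mu>)"
    unfolding sets_sigma_coords
  proof (rule sets.sigma_sets_subset[of _ "vimage_algebra (space M) ?\<rho> \<mu>", unfolded space_vimage_algebra], safe)
    fix j A assume "j \<in> L" "A \<in> sets (E j)"
    then have "(\<lambda>\<omega>. X \<omega> j) -` A \<inter> space M = ?\<rho> -` {x \<in> space \<mu>. x j \<in> A} \<inter> space M"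
      using \<rho> by (auto simp: override_on_def)
    also have "\<dots> \<in> sets (vimage_algebra (space M) ?\<rho> \<mu>)"
      using \<open>A \<in> sets (E j)\<close> by (intro in_vimage_algebra) simp
    finally show "(\<lambda>\<omega>. X \<omega> j) -` A \<inter> space M \<in> sets (vimage_algebra (space M) ?\<rho> \<mu>)" .
  qed
  with A have "A \<in> {?\<rho> -` B \<inter> space M | B. B \<in> sets \<mu>}"
    using sets_vimage_algebra2[OF \<rho>] by auto
  with that show thesis by auto
qed

text \<open>The indicator of a set in \<open>\<sigma>C L\<close> is a function of \<open>X\<close>
  that depends only on the coordinates in \<open>L\<close>. It therefore passes through
  \<open>cond L\<close>, and the defining property of conditional expectation becomes invariance of
  the integral under \<open>cond L\<close>.\<close>

lemma real_cond_exp_sigma_coords: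
  assumes f: "integrable \<mu> f" and F: "F \<in> borel_measurable M" "AE \<omega> in M. F \<omega> = f (X \<omega>)"
  shows "AE \<omega> in M. real_cond_exp M (\<sigma>C L) F \<omega> = base.cond L f (X \<omega>)"
proof (rule coords.real_cond_exp_charact)
  note [measurable] = borel_measurable_integrable[OF f] F(1)
  note [measurable] = borel_measurable_integrable[OF base.integrable_cond[OF f, of L]]
  have fX: "integrable M (\<lambda>\<omega>. f (X \<omega>))"
    using f by (subst distr_transfer(1)[OF X_measurable X_distr]) auto
  then show "integrable M F"
    using F by (subst integrable_cong_AE[of _ _ "\<lambda>\<omega>. f (X \<omega>)"]) auto
  show "integrable M (\<lambda>\<omega>. base.cond L f (X \<omega>))"
    using base.integrable_cond[OF f, of L] by (subst distr_transfer(1)[OF X_measurable X_distr]) auto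
  obtain p where p: "p \<in> space \<mu>" using base.P.not_empty by blast
  \<comment> \<open>Factoring through the filled sequence is what yields measurability with respect
    to \<open>\<sigma>C L\<close>.\<close>
  have "base.cond L f (override_on p (X \<omega>) L) = base.cond L f (X \<omega>)" for \<omega>
    by (rule depends_only_on_override_on) (rule base.depends_only_on_cond)
  moreover have "(\<lambda>\<omega>. base.cond L f (override_on p (X \<omega>) L)) \<in> borel_measurable (\<sigma>C L)"
    by (rule measurable_compose[OF measurable_fill_sigma_coords[OF p]]) simp
  ultimately show "(\<lambda>\<omega>. base.cond L f (X \<omega>)) \<in> borel_measurable (\<sigma>C L)" by simp
  fix A assume "A \<in> sets (\<sigma>C L)"
  then obtain B where B [measurable]: "B \<in> sets \<mu>" and A: "A = (\<lambda>\<omega>. override_on p (X \<omega>) L) -` B \<inter> space M"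
    by (rule sigma_coordsE[OF p])
  have [measurable]: "A \<in> sets M"
    using \<open>A \<in> sets (\<sigma>C L)\<close> subalgebra_sigma_coords by (auto simp: subalgebra_def)
  let ?b = "\<lambda>x. indicator B (override_on p x L) :: real"
  have b: "depends_only_on L ?b"
    unfolding depends_only_on_def
  proof (intro allI impI)
    fix x x' :: "nat \<Rightarrow> 'a" assume "\<forall>k\<in>L. x k = x' k"
    then have "override_on p x L = override_on p x' L"
      by (auto simp: override_on_def)
    then show "?b x = ?b x'" by simp
  qed
  have [measurable]: "(\<lambda>x. override_on p x L) \<in> measurable \<mu> \<mu>"
    using p by (intro measurable_override_on) auto
  have bf: "integrable \<mu> (\<lambda>x. ?b x * f x)"
    by (rule Bochner_Integration.integrable_bound[OF f]) (auto simp: indicator_def)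
  have ind: "indicator A \<omega> = ?b (X \<omega>)" if "\<omega> \<in> space M" for \<omega>
    using that by (auto simp: A indicator_def)
  have "(\<integral>\<omega>\<in>A. F \<omega> \<partial>M) = (\<integral>\<omega>. ?b (X \<omega>) * f (X \<omega>) \<partial>M)"
    unfolding set_lebesgue_integral_def
  proof (rule integral_cong_AE)
    show "AE \<omega> in M. indicator A \<omega> *\<^sub>R F \<omega> = ?b (X \<omega>) * f (X \<omega>)"
      using F(2) AE_space by eventually_elim (simp add: ind)
  qed measurable
  also have "\<dots> = (\<integral>x. ?b x * f x \<partial>\<mu>)"
    by (rule distr_transfer(2)[OF X_measurable X_distr]) measurable
  also have "\<dots> = (\<integral>x. ?b x * base.cond L f x \<partial>\<mu>)"
    using base.integral_cond[OF bf, of L] by (simp add: base.cond_mult[OF b])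
  also have "\<dots> = (\<integral>\<omega>. ?b (X \<omega>) * base.cond L f (X \<omega>) \<partial>M)"
    by (rule distr_transfer(2)[OF X_measurable X_distr, symmetric]) measurable
  also have "\<dots> = (\<integral>\<omega>\<in>A. base.cond L f (X \<omega>) \<partial>M)"
    unfolding set_lebesgue_integral_def
    by (intro Bochner_Integration.integral_cong) (auto simp: ind)
  finally show "(\<integral>\<omega>\<in>A. F \<omega> \<partial>M) = (\<integral>\<omega>\<in>A. base.cond L f (X \<omega>) \<partial>M)" .
qed

lemma hoeffding_term_eq:
  assumes f: "integrable \<mu> f" and F: "F \<in> borel_measurable M" "AE \<omega> in M. F \<omega> = f (X \<omega>)"
    and K: "finite K"
  shows "AE \<omega> in M. hoeffding_term M E X F K \<omega> = base.hoeffding K f (X \<omega>)"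
proof -
  have "AE \<omega> in M. \<forall>L\<in>Pow K. real_cond_exp M (\<sigma>C L) F \<omega> = base.cond L f (X \<omega>)"
    using K by (intro AE_finite_allI real_cond_exp_sigma_coords f F) auto
  then show ?thesis
    by eventually_elim (simp add: hoeffding_term_def base.hoeffding_def mobius_def)
qed

section \<open>Joint law of the clocks and the two sequences\<close>

abbreviation "\<nu> \<equiv> distr M (PiM UNIV (\<lambda>_. borel)) (\<lambda>\<omega> k. Z k \<omega>)"

lemma measurable_Z_seq [measurable]:
  "(\<lambda>\<omega> k. Z k \<omega>) \<in> measurable M (PiM UNIV (\<lambda>_. borel :: real measure))"
  by (rule measurable_PiM_single') auto

lemma prob_space_\<nu>: "prob_space \<nu>"
  by (rule prob_space_distr) simp

sublocale joint: pair_prob_space \<nu> "\<mu> \<Otimes>\<^sub>M \<mu>"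
  by (intro pair_prob_space.intro pair_sigma_finite.intro prob_space_imp_sigma_finite
      prob_space_\<nu> base.pair.prob_space_axioms)

lemma distr_pair_X: "distr M (\<mu> \<Otimes>\<^sub>M \<mu>) (\<lambda>\<omega>. (X \<omega>, X' \<omega>)) = \<mu> \<Otimes>\<^sub>M \<mu>"
  using X_X'_indep by (simp add: indep_var_distribution_eq X_distr X'_distr)

text \<open>Independence checked on rectangles. The clocks are the first component so that Fubini
  freezes \<open>z\<close>, and with it the retained set, before the two sequences are
  integrated.\<close>

lemma distr_joint:
  "distr M (\<nu> \<Otimes>\<^sub>M (\<mu> \<Otimes>\<^sub>M \<mu>)) (\<lambda>\<omega>. (\<lambda>k. Z k \<omega>, (X \<omega>, X' \<omega>))) = \<nu> \<Otimes>\<^sub>M (\<mu> \<Otimes>\<^sub>M \<mu>)"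
proof (rule pair_measure_eqI[symmetric])
  show "sigma_finite_measure \<nu>" "sigma_finite_measure (\<mu> \<Otimes>\<^sub>M \<mu>)"
    by (intro prob_space_imp_sigma_finite prob_space_\<nu> base.pair.prob_space_axioms)+
  fix A B assume "A \<in> sets \<nu>" and B [measurable]: "B \<in> sets (\<mu> \<Otimes>\<^sub>M \<mu>)"
  then have A [measurable]: "A \<in> sets (PiM UNIV (\<lambda>_. borel))" by simp
  let ?A = "(\<lambda>\<omega> k. Z k \<omega>) -` A \<inter> space M" and ?B = "(\<lambda>\<omega>. (X \<omega>, X' \<omega>)) -` B \<inter> space M"
  have "prob (?B \<inter> ?A) = prob ?B * prob ?A"
    by (rule indep_setD[OF Z_indep_X_X']) (auto intro: in_vimage_algebra)
  then have *: "emeasure M (?B \<inter> ?A) = emeasure M ?B * emeasure M ?A"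
    by (simp add: emeasure_eq_measure ennreal_mult)
  have "emeasure \<nu> A = emeasure M ?A"
    by (rule emeasure_distr) auto
  moreover have "emeasure (\<mu> \<Otimes>\<^sub>M \<mu>) B = emeasure M ?B"
    by (subst distr_pair_X[symmetric], rule emeasure_distr) auto
  moreover have "emeasure (distr M (\<nu> \<Otimes>\<^sub>M (\<mu> \<Otimes>\<^sub>M \<mu>)) (\<lambda>\<omega>. (\<lambda>k. Z k \<omega>, (X \<omega>, X' \<omega>)))) (A \<times> B) =
      emeasure M (?B \<inter> ?A)"
    by (subst emeasure_distr) (auto intro!: arg_cong[where f = "emeasure M"])
  ultimately show "emeasure \<nu> A * emeasure (\<mu> \<Otimes>\<^sub>M \<mu>) B =
      emeasure (distr M (\<nu> \<Otimes>\<^sub>M (\<mu> \<Otimes>\<^sub>M \<mu>)) (\<lambda>\<omega>. (\<lambda>k. Z k \<omega>, (X \<omega>, X' \<omega>)))) (A \<times> B)"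
    using * by (simp add: mult.commute)
qed simp

abbreviation "J t z \<equiv> {k. z k > (t :: real)}"

lemma Xt_eq: "Xt t \<omega> = override_on (X' \<omega>) (X \<omega>) (J t (\<lambda>k. Z k \<omega>))"
  by (simp add: resampled_def override_on_def fun_eq_iff)

lemma measurable_override_on_joint [measurable]:
  "(\<lambda>p. override_on (snd (snd p)) (fst (snd p)) (J t (fst p))) \<in> measurable (\<nu> \<Otimes>\<^sub>M (\<mu> \<Otimes>\<^sub>M \<mu>)) \<mu>"
  by (rule measurable_override_on) measurable

text \<open>For each frozen \<open>z\<close> the retained set is deterministic and
  \<open>distr_override_on\<close> applies; averaging a constant over \<open>z\<close> changes
  nothing.\<close>

lemma distr_Xt: "distr M \<mu> (Xt t) = \<mu>"
proof (rule measure_eqI)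
  fix A assume "A \<in> sets (distr M \<mu> (Xt t))"
  then have A [measurable]: "A \<in> sets \<mu>" by simp
  let ?r = "\<lambda>p. override_on (snd (snd p)) (fst (snd p)) (J t (fst p))"
  let ?S = "?r -` A \<inter> space (\<nu> \<Otimes>\<^sub>M (\<mu> \<Otimes>\<^sub>M \<mu>))"
  have S: "?S \<in> sets (\<nu> \<Otimes>\<^sub>M (\<mu> \<Otimes>\<^sub>M \<mu>))"
    by measurable
  have "emeasure (distr M \<mu> (Xt t)) A = emeasure M (Xt t -` A \<inter> space M)"
    by (rule emeasure_distr) auto
  also have "Xt t -` A \<inter> space M = (\<lambda>\<omega>. (\<lambda>k. Z k \<omega>, (X \<omega>, X' \<omega>))) -` ?S \<inter> space M"
    using measurable_space[OF X_measurable] measurable_space[OF X'_measurable]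
    by (auto simp: Xt_eq space_pair_measure space_PiM)
  also have "emeasure M \<dots> =
      emeasure (distr M (\<nu> \<Otimes>\<^sub>M (\<mu> \<Otimes>\<^sub>M \<mu>)) (\<lambda>\<omega>. (\<lambda>k. Z k \<omega>, (X \<omega>, X' \<omega>)))) ?S"
    using S by (intro emeasure_distr[symmetric]) auto
  also have "\<dots> = (\<integral>\<^sup>+z. emeasure (\<mu> \<Otimes>\<^sub>M \<mu>) (Pair z -` ?S) \<partial>\<nu>)"
    unfolding distr_joint using S
    by (rule sigma_finite_measure.emeasure_pair_measure_alt[OF
          prob_space_imp_sigma_finite[OF base.pair.prob_space_axioms]])
  also have "\<dots> = (\<integral>\<^sup>+z. emeasure \<mu> A \<partial>\<nu>)"
  proof (rule nn_integral_cong)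
    fix z assume "z \<in> space \<nu>"
    then have "Pair z -` ?S = (\<lambda>p. override_on (snd p) (fst p) (J t z)) -` A \<inter> space (\<mu> \<Otimes>\<^sub>M \<mu>)"
      by (auto simp: space_pair_measure)
    also have "emeasure (\<mu> \<Otimes>\<^sub>M \<mu>) \<dots> =
        emeasure (distr (\<mu> \<Otimes>\<^sub>M \<mu>) \<mu> (\<lambda>p. override_on (snd p) (fst p) (J t z))) A"
      by (rule emeasure_distr[symmetric]) auto
    finally show "emeasure (\<mu> \<Otimes>\<^sub>M \<mu>) (Pair z -` ?S) = emeasure \<mu> A"
      by (simp add: base.distr_override_on)
  qed
  also have "\<dots> = emeasure \<mu> A"
    using prob_space.emeasure_space_1[OF prob_space_\<nu>] by simp
  finally show "emeasure (distr M \<mu> (Xt t)) A = emeasure \<mu> A" .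
qed simp

lemma prob_Z_greater:
  assumes "finite K" "t \<ge> 0"
  shows "prob {\<omega> \<in> space M. \<forall>k\<in>K. Z k \<omega> > t} = exp (- t * real (card K))"
\<comment> \<open>The product rule for independent events is applied to a nonempty index set, and an
  empty intersection would not be confined to \<open>space M\<close>.\<close>
proof (cases "K = {}")
  case True
  then show ?thesis by (simp add: prob_space)
next
  case False
  have "{\<omega> \<in> space M. \<forall>k\<in>K. Z k \<omega> > t} = (\<Inter>k\<in>K. Z k -` {t<..} \<inter> space M)"
    using False by auto
  also have "prob \<dots> = (\<Prod>k\<in>K. prob (Z k -` {t<..} \<inter> space M))"
    using assms False by (intro indep_varsD[OF Z_indep]) auto
  also have "\<dots> = (\<Prod>k\<in>K. exp (- t))"
  proof (rule prod.cong[OF refl])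
    fix k
    have "Z k -` {t<..} \<inter> space M = {\<omega> \<in> space M. t < Z k \<omega>}" by auto
    then show "prob (Z k -` {t<..} \<inter> space M) = exp (- t)"
      using exponential_distributedD_gt[OF Z_exponential[of k] assms(2)] by simp
  qed
  also have "\<dots> = exp (- t * real (card K))"
    by (simp add: exp_of_nat_mult[symmetric] mult.commute)
  finally show ?thesis .
qed

section \<open>Conditioning the resampled function on the whole sequence\<close>

lemma integral_indicator_mult_Xt:
  assumes f: "f \<in> L2 \<mu>" and N: "finite N" and t: "t \<ge> 0" and B [measurable]: "B \<in> sets \<mu>"
  shows "(\<integral>\<omega>. indicator B (X \<omega>) * base.cond N f (Xt t \<omega>) \<partial>M) =
    (\<integral>x. indicator B x * (\<Sum>K\<in>Pow N. exp (- t * real (card K)) * base.hoeffding K f x) \<partial>\<mu>)"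
proof -
  let ?g = "base.cond N f" and ?b = "indicator B :: _ \<Rightarrow> real"
  let ?h = "\<lambda>p. ?b (fst (snd p)) * ?g (override_on (snd (snd p)) (fst (snd p)) (J t (fst p)))"
  let ?m = "\<lambda>K. \<integral>x. ?b x * base.hoeffding K f x \<partial>\<mu>"
  have g: "?g \<in> L2 \<mu>" using f by (rule base.L2_cond)
  note [measurable] = L2_borel_measurable[OF g] L2_borel_measurable[OF f]
    L2_borel_measurable[OF base.L2_cond[OF f]] L2_borel_measurable[OF base.L2_hoeffding[OF f]]
  have bH: "integrable \<mu> (\<lambda>x. ?b x * base.hoeffding K f x)" for K
    by (intro L2_integrable_mult base.P.L2_indicator base.L2_hoeffding f B)
  \<comment> \<open>With \<open>z\<close> frozen, integrating out the second copy is
    \<open>cond (J t z)\<close>. The indicators turn the random range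
    \<open>Pow (J t z \<inter> N)\<close> into the fixed range \<open>Pow N\<close>, so
    \<open>z\<close> then occurs in bounded scalar weights only.\<close>
  have inner: "(\<integral>p. ?h (z, p) \<partial>(\<mu> \<Otimes>\<^sub>M \<mu>)) = (\<Sum>K\<in>Pow N. indicator {z. \<forall>k\<in>K. z k > t} z * ?m K)" for z
  proof -
    let ?q = "\<lambda>p. ?b (fst p) * ?g (override_on (snd p) (fst p) (J t z))"
    have int_g: "integrable (\<mu> \<Otimes>\<^sub>M \<mu>) (\<lambda>p. ?g (override_on (snd p) (fst p) (J t z)))"
      by (rule base.integrable_override_on[OF base.P.L2_integrable[OF g]])
    have "integrable (\<mu> \<Otimes>\<^sub>M \<mu>) ?q"
      by (rule Bochner_Integration.integrable_bound[OF int_g]) (auto simp: indicator_def)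
    from base.pair.integral_fst'[OF this]
    have "(\<integral>p. ?h (z, p) \<partial>(\<mu> \<Otimes>\<^sub>M \<mu>)) = (\<integral>x. ?b x * base.cond (J t z) ?g x \<partial>\<mu>)"
      by (simp add: base.cond_def)
    also have "\<dots> = (\<integral>x. ?b x * base.cond (J t z \<inter> N) f x \<partial>\<mu>)"
    proof (rule integral_cong_AE)
      show "AE x in \<mu>. ?b x * base.cond (J t z) ?g x = ?b x * base.cond (J t z \<inter> N) f x"
        using base.cond_cond[OF base.P.L2_integrable[OF f], of "J t z" N] by eventually_elim simp
      show "(\<lambda>x. ?b x * base.cond (J t z) ?g x) \<in> borel_measurable \<mu>"
        using base.L2_cond[OF g, of "J t z"] by measurable
    qed measurable
    also have "\<dots> = (\<integral>x. (\<Sum>K\<in>Pow (J t z \<inter> N). ?b x * base.hoeffding K f x) \<partial>\<mu>)"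
      unfolding sum_distrib_left[symmetric] base.sum_hoeffding[OF finite_Int[OF disjI2, OF N]] ..
    also have "\<dots> = (\<Sum>K\<in>Pow (J t z \<inter> N). ?m K)"
      using bH by (rule Bochner_Integration.integral_sum)
    also have "\<dots> = (\<Sum>K\<in>Pow N. indicator {z. \<forall>k\<in>K. z k > t} z * ?m K)"
      using N by (intro sum.mono_neutral_cong_left) (auto simp: indicator_def)
    finally show ?thesis .
  qed
  \<comment> \<open>The integrability needed for Fubini is pulled from the law of
    \<open>Xt t\<close>.\<close>
  have "integrable M (\<lambda>\<omega>. ?g (Xt t \<omega>))"
    using base.P.L2_integrable[OF g] distr_transfer(1)[OF measurable_Xt distr_Xt] by simp
  then have "integrable M (\<lambda>\<omega>. ?b (X \<omega>) * ?g (Xt t \<omega>))"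
    by (rule Bochner_Integration.integrable_bound) (auto simp: indicator_def)
  then have int_h: "integrable (\<nu> \<Otimes>\<^sub>M (\<mu> \<Otimes>\<^sub>M \<mu>)) ?h"
    by (subst distr_joint[symmetric], subst integrable_distr_eq) (simp_all add: Xt_eq)
  have "(\<integral>\<omega>. ?b (X \<omega>) * ?g (Xt t \<omega>) \<partial>M) = (\<integral>p. ?h p \<partial>(\<nu> \<Otimes>\<^sub>M (\<mu> \<Otimes>\<^sub>M \<mu>)))"
    by (subst distr_joint[symmetric], subst integral_distr) (simp_all add: Xt_eq)
  also have "\<dots> = (\<integral>z. (\<integral>p. ?h (z, p) \<partial>(\<mu> \<Otimes>\<^sub>M \<mu>)) \<partial>\<nu>)"
    by (rule joint.integral_fst'[OF int_h, symmetric])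
  also have "\<dots> = (\<integral>z. (\<Sum>K\<in>Pow N. indicator {z. \<forall>k\<in>K. z k > t} z * ?m K) \<partial>\<nu>)"
    unfolding inner ..
  also have "\<dots> = (\<integral>\<omega>. (\<Sum>K\<in>Pow N. indicator {\<omega> \<in> space M. \<forall>k\<in>K. Z k \<omega> > t} \<omega> * ?m K) \<partial>M)"
  proof (subst integral_distr)
    show "(\<lambda>z. \<Sum>K\<in>Pow N. indicator {z. \<forall>k\<in>K. z k > t} z * ?m K) \<in>
        borel_measurable (PiM UNIV (\<lambda>_. borel :: real measure))"
    proof (intro borel_measurable_sum borel_measurable_times borel_measurable_const)
      fix K assume "K \<in> Pow N"
      then have [measurable]: "finite K" using N by (auto intro: finite_subset)
      have "Measurable.pred (PiM UNIV (\<lambda>_. borel :: real measure)) (\<lambda>z. \<forall>k\<in>K. z k > t)"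
        by (intro pred_intros_finite) measurable
      then show "(indicator {z. \<forall>k\<in>K. z k > t} :: _ \<Rightarrow> real) \<in>
          borel_measurable (PiM UNIV (\<lambda>_. borel :: real measure))"
        by (intro borel_measurable_indicator') simp
    qed
  qed (auto intro!: Bochner_Integration.integral_cong sum.cong simp: indicator_def)
  also have "\<dots> = (\<Sum>K\<in>Pow N. exp (- t * real (card K)) * ?m K)"
  proof (subst Bochner_Integration.integral_sum)
    fix K assume "K \<in> Pow N"
    then have K: "finite K" using N by (auto intro: finite_subset)
    have "{\<omega> \<in> space M. \<forall>k\<in>K. Z k \<omega> > t} \<in> sets M"
      using K by (intro sets.sets_Collect_finite_All) auto
    then show "integrable M (\<lambda>\<omega>. indicator {\<omega> \<in> space M. \<forall>k\<in>K. Z k \<omega> > t} \<omega> * ?m K)"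
      by (auto simp: emeasure_eq_measure)
  next
    show "(\<Sum>K\<in>Pow N. \<integral>\<omega>. indicator {\<omega> \<in> space M. \<forall>k\<in>K. Z k \<omega> > t} \<omega> * ?m K \<partial>M) =
        (\<Sum>K\<in>Pow N. exp (- t * real (card K)) * ?m K)"
    proof (rule sum.cong[OF refl])
      fix K assume "K \<in> Pow N"
      then have K: "finite K" using N by (auto intro: finite_subset)
      show "(\<integral>\<omega>. indicator {\<omega> \<in> space M. \<forall>k\<in>K. Z k \<omega> > t} \<omega> * ?m K \<partial>M) =
          exp (- t * real (card K)) * ?m K"
        using prob_Z_greater[OF K t] by simp
    qed
  qed
  also have "\<dots> = (\<integral>x. (\<Sum>K\<in>Pow N. exp (- t * real (card K)) * (?b x * base.hoeffding K f x)) \<partial>\<mu>)"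
    using bH by (subst Bochner_Integration.integral_sum) auto
  finally show ?thesis
    by (simp add: sum_distrib_left mult_ac)
qed

text \<open>Every set in \<open>\<sigma>X\<close> is the preimage under \<open>X\<close> of some
  \<open>B\<close>, so \<open>integral_indicator_mult_Xt\<close> is exactly the defining property of
  the conditional expectation.\<close>

lemma real_cond_exp_cond_Xt:
  assumes f: "f \<in> L2 \<mu>" and N: "finite N" and t: "t \<ge> 0"
  shows "AE \<omega> in M. real_cond_exp M \<sigma>X (\<lambda>\<omega>. base.cond N f (Xt t \<omega>)) \<omega> =
    (\<Sum>K\<in>Pow N. exp (- t * real (card K)) * base.hoeffding K f (X \<omega>))"
proof (rule seq.real_cond_exp_charact)
  let ?s = "\<lambda>x. \<Sum>K\<in>Pow N. exp (- t * real (card K)) * base.hoeffding K f x"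
  have s: "?s \<in> L2 \<mu>"
    by (intro L2_sum_mem L2_cmult base.L2_hoeffding f)
  have g: "base.cond N f \<in> L2 \<mu>" using f by (rule base.L2_cond)
  have [measurable]: "?s \<in> borel_measurable \<mu>" "base.cond N f \<in> borel_measurable \<mu>"
    using s g by simp_all
  show "integrable M (\<lambda>\<omega>. base.cond N f (Xt t \<omega>))"
    by (intro L2_integrable L2_transfer[OF measurable_Xt distr_Xt] g)
  show "integrable M (\<lambda>\<omega>. ?s (X \<omega>))"
    by (rule L2_integrable[OF L2_transfer[OF X_measurable X_distr s]])
  show "(\<lambda>\<omega>. ?s (X \<omega>)) \<in> borel_measurable \<sigma>X"
    by (rule measurable_compose[OF measurable_X_sigma_seq, of ?s]) measurable
  fix A assume "A \<in> sets \<sigma>X"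
  then obtain B where A: "A = X -` B \<inter> space M" and B [measurable]: "B \<in> sets \<mu>"
    by (auto simp: sets_sigma_seq)
  have "(\<integral>\<omega>\<in>A. base.cond N f (Xt t \<omega>) \<partial>M) = (\<integral>\<omega>. indicator B (X \<omega>) * base.cond N f (Xt t \<omega>) \<partial>M)"
    unfolding set_lebesgue_integral_def
    by (intro Bochner_Integration.integral_cong) (auto simp: A indicator_def)
  also have "\<dots> = (\<integral>x. indicator B x * ?s x \<partial>\<mu>)"
    by (rule integral_indicator_mult_Xt[OF f N t B])
  also have "\<dots> = (\<integral>\<omega>. indicator B (X \<omega>) * ?s (X \<omega>) \<partial>M)"
    by (rule distr_transfer(2)[OF X_measurable X_distr, symmetric]) measurable
  also have "\<dots> = (\<integral>\<omega>\<in>A. ?s (X \<omega>) \<partial>M)"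
    unfolding set_lebesgue_integral_def
    by (intro Bochner_Integration.integral_cong) (auto simp: A indicator_def)
  finally show "(\<integral>\<omega>\<in>A. base.cond N f (Xt t \<omega>) \<partial>M) = (\<integral>\<omega>\<in>A. ?s (X \<omega>) \<partial>M)" .
qed

text \<open>The contraction: conditional Jensen for the square, then \<open>distr_Xt\<close> to
  return to \<mu>.\<close>

lemma
  assumes h: "h \<in> L2 \<mu>"
  shows L2_real_cond_exp_Xt: "real_cond_exp M \<sigma>X (\<lambda>\<omega>. h (Xt t \<omega>)) \<in> L2 M"
    and integral_real_cond_exp_Xt_square_le:
      "(\<integral>\<omega>. (real_cond_exp M \<sigma>X (\<lambda>\<omega>. h (Xt t \<omega>)) \<omega>)\<^sup>2 \<partial>M) \<le> (\<integral>x. (h x)\<^sup>2 \<partial>\<mu>)"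
proof -
  let ?G = "real_cond_exp M \<sigma>X (\<lambda>\<omega>. h (Xt t \<omega>))"
  let ?Q = "real_cond_exp M \<sigma>X (\<lambda>\<omega>. (h (Xt t \<omega>))\<^sup>2)"
  have [measurable]: "h \<in> borel_measurable \<mu>" using h by simp
  have hX: "(\<lambda>\<omega>. h (Xt t \<omega>)) \<in> L2 M"
    by (rule L2_transfer[OF measurable_Xt distr_Xt h])
  have jensen: "AE \<omega> in M. (?G \<omega>)\<^sup>2 \<le> ?Q \<omega>"
    by (rule seq.real_cond_exp_jensens_inequality(2)[where I = UNIV])
      (use hX convex_power2 in \<open>auto intro!: L2_integrable L2_integrable_square\<close>)
  have Q: "integrable M ?Q"
    by (intro seq.real_cond_exp_int L2_integrable_square hX)
  show G: "?G \<in> L2 M"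
    unfolding L2_def
  proof safe
    show "integrable M (\<lambda>\<omega>. (?G \<omega>)\<^sup>2)"
      using jensen by (intro Bochner_Integration.integrable_bound[OF Q]) auto
  qed simp
  have "(\<integral>\<omega>. (?G \<omega>)\<^sup>2 \<partial>M) \<le> (\<integral>\<omega>. ?Q \<omega> \<partial>M)"
    using jensen Q L2_integrable_square[OF G] by (intro integral_mono_AE)
  also have "\<dots> = (\<integral>\<omega>. (h (Xt t \<omega>))\<^sup>2 \<partial>M)"
    by (intro seq.real_cond_exp_int L2_integrable_square hX)
  also have "\<dots> = (\<integral>x. (h x)\<^sup>2 \<partial>\<mu>)"
    by (rule distr_transfer(2)[OF measurable_Xt distr_Xt]) measurable
  finally show "(\<integral>\<omega>. (?G \<omega>)\<^sup>2 \<partial>M) \<le> (\<integral>x. (h x)\<^sup>2 \<partial>\<mu>)" .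
qed

lemma L2_has_sum_hoeffding_real_cond_exp:
  assumes f: "f \<in> L2 \<mu>" and F: "F \<in> borel_measurable M" "AE \<omega> in M. F \<omega> = f (X \<omega>)" and t: "t \<ge> 0"
  shows "L2_has_sum M (\<lambda>K \<omega>. exp (- t * real (card K)) * hoeffding_term M E X F K \<omega>) {K. finite K}
    (real_cond_exp M \<sigma>X (\<lambda>\<omega>. f (Xt t \<omega>)))"
  unfolding L2_has_sum_def
proof (intro conjI ballI)
  let ?c = "\<lambda>K. exp (- t * real (card K))"
  let ?u = "\<lambda>K \<omega>. ?c K * hoeffding_term M E X F K \<omega>"
  let ?v = "\<lambda>K x. ?c K * base.hoeffding K f x"
  let ?G = "\<lambda>h. real_cond_exp M \<sigma>X (\<lambda>\<omega>. h (Xt t \<omega>))"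
  have v: "?v K \<in> L2 \<mu>" for K
    by (intro L2_cmult base.L2_hoeffding f)
  have vX: "(\<lambda>\<omega>. ?v K (X \<omega>)) \<in> L2 M" for K
    using L2_transfer[OF X_measurable X_distr v[of K]] by simp
  have uv: "AE \<omega> in M. ?u K \<omega> = ?v K (X \<omega>)" if "finite K" for K
    using hoeffding_term_eq[OF base.P.L2_integrable[OF f] F that] by eventually_elim simp
  have u_meas [measurable]: "?u K \<in> borel_measurable M" for K
    unfolding hoeffding_term_def[abs_def] by measurable
  show "?u K \<in> L2 M" if "K \<in> {K. finite K}" for K
  proof (rule L2_AE_cong[OF vX u_meas])
    show "AE \<omega> in M. ?v K (X \<omega>) = ?u K \<omega>"
      using uv[of K] that by auto
  qed
  show G: "?G f \<in> L2 M"
    by (rule L2_real_cond_exp_Xt[OF f])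
  show "((\<lambda>S. \<integral>\<omega>. ((\<Sum>K\<in>S. ?u K \<omega>) - ?G f \<omega>)\<^sup>2 \<partial>M) \<longlongrightarrow> 0) (finite_subsets_at_top {K. finite K})"
  proof (rule tendstoI)
    fix \<epsilon> :: real assume "\<epsilon> > 0"
    then have "\<epsilon> / 4 > 0" by simp
    then obtain N where N: "finite N" "(\<integral>x. (f x - base.cond N f x)\<^sup>2 \<partial>\<mu>) < \<epsilon> / 4"
      using base.cond_approximation[OF f] by blast
    let ?g = "base.cond N f" and ?R = "\<lambda>x. \<Sum>K\<in>Pow N. ?v K x"
    have g: "?g \<in> L2 \<mu>" using f by (rule base.L2_cond)
    have gf: "(\<lambda>x. ?g x - f x) \<in> L2 \<mu>" using g f by (rule L2_diff)
    have R: "?R \<in> L2 \<mu>" using v by (rule L2_sum_mem)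
    have "AE \<omega> in M. ?G (\<lambda>x. ?g x - f x) \<omega> = ?G ?g \<omega> - ?G f \<omega>"
      by (rule seq.real_cond_exp_diff)
        (intro L2_integrable L2_transfer[OF measurable_Xt distr_Xt] f g)+
    with real_cond_exp_cond_Xt[OF f N(1) t]
    have GR: "AE \<omega> in M. ?G (\<lambda>x. ?g x - f x) \<omega> = ?R (X \<omega>) - ?G f \<omega>"
      by eventually_elim simp
    have "dist (\<integral>\<omega>. ((\<Sum>K\<in>S. ?u K \<omega>) - ?G f \<omega>)\<^sup>2 \<partial>M) 0 < \<epsilon>"
      if S: "finite S" "S \<subseteq> {K. finite K}" "Pow N \<subseteq> S" for S
    proof -
      let ?T = "\<lambda>x. \<Sum>K\<in>S. ?v K x"
      have T: "?T \<in> L2 \<mu>" using v by (rule L2_sum_mem)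
      have TR: "(\<lambda>x. ?T x - ?R x) \<in> L2 \<mu>" using T R by (rule L2_diff)
      note TRX = L2_transfer[OF X_measurable X_distr TR]
      note Ggf = L2_real_cond_exp_Xt[OF gf, of t]
      have "AE \<omega> in M. \<forall>K\<in>S. ?u K \<omega> = ?v K (X \<omega>)"
        using S by (intro AE_finite_allI uv) auto
      \<comment> \<open>The sum over \<open>Pow N\<close>, which equals \<open>?G ?g\<close> almost
        surely, is inserted between the partial sum and the limit. The tail and the contracted
        truncation error are both bounded by the same squared distance from \<open>f\<close> to
        \<open>cond N f\<close>.\<close>
      with GR have "AE \<omega> in M. (\<Sum>K\<in>S. ?u K \<omega>) - ?G f \<omega> = (?T (X \<omega>) - ?R (X \<omega>)) + ?G (\<lambda>x. ?g x - f x) \<omega>"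
        by eventually_elim simp
      then have "(\<integral>\<omega>. ((\<Sum>K\<in>S. ?u K \<omega>) - ?G f \<omega>)\<^sup>2 \<partial>M) =
          (\<integral>\<omega>. ((?T (X \<omega>) - ?R (X \<omega>)) + ?G (\<lambda>x. ?g x - f x) \<omega>)\<^sup>2 \<partial>M)"
        by (intro integral_cong_AE borel_measurable_power borel_measurable_diff borel_measurable_add
            borel_measurable_sum u_meas vX[THEN L2_borel_measurable]
            Ggf[THEN L2_borel_measurable] G[THEN L2_borel_measurable])
          (erule eventually_mono, simp only:)
      also have "\<dots> \<le> 2 * (\<integral>\<omega>. (?T (X \<omega>) - ?R (X \<omega>))\<^sup>2 \<partial>M) + 2 * (\<integral>\<omega>. (?G (\<lambda>x. ?g x - f x) \<omega>)\<^sup>2 \<partial>M)"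
        using TRX Ggf by (rule integral_add_square_le)
      also have "(\<integral>\<omega>. (?T (X \<omega>) - ?R (X \<omega>))\<^sup>2 \<partial>M) = (\<integral>x. (?T x - ?R x)\<^sup>2 \<partial>\<mu>)"
        using L2_borel_measurable[OF TR]
        by (intro distr_transfer(2)[OF X_measurable X_distr, of "\<lambda>x. (?T x - ?R x)\<^sup>2"]) simp
      also have "\<dots> \<le> (\<integral>x. (f x - ?g x)\<^sup>2 \<partial>\<mu>)"
        \<comment> \<open>Here \<open>t \<ge> 0\<close> enters as the bound 1 on the
          weights.\<close>
        using S t N(1) by (intro base.integral_sum_hoeffding_tail_le f) auto
      also have "(\<integral>\<omega>. (?G (\<lambda>x. ?g x - f x) \<omega>)\<^sup>2 \<partial>M) \<le> (\<integral>x. (?g x - f x)\<^sup>2 \<partial>\<mu>)"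
        by (rule integral_real_cond_exp_Xt_square_le[OF gf])
      also have "\<dots> = (\<integral>x. (f x - ?g x)\<^sup>2 \<partial>\<mu>)"
        by (simp add: power2_commute)
      finally show ?thesis
        using N(2) by simp
    qed
    then show "\<forall>\<^sub>F S in finite_subsets_at_top {K. finite K}.
        dist (\<integral>\<omega>. ((\<Sum>K\<in>S. ?u K \<omega>) - ?G f \<omega>)\<^sup>2 \<partial>M) 0 < \<epsilon>"
      unfolding eventually_finite_subsets_at_top using N(1)
      by (intro exI[of _ "Pow N"]) (auto intro: finite_subset)
  qed
qed

end

theorem proposition2p13:
  fixes M :: "'w measure"
    and E :: "nat \<Rightarrow> 'a measure"
    and X X' :: "'w \<Rightarrow> nat \<Rightarrow> 'a"
    and Z :: "nat \<Rightarrow> 'w \<Rightarrow> real"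
    and F :: "'w \<Rightarrow> real"
    and f :: "(nat \<Rightarrow> 'a) \<Rightarrow> real"
    and t :: real
  assumes "resampling_setting M E X X' Z"
    and "t \<ge> 0"
    and "F \<in> L2_seq M E X"
    and "representative M E X F f"
  shows "AE \<omega> in M. OU_semigroup M E X t F \<omega> =
           real_cond_exp M (sigma_seq M E X) (\<lambda>\<omega>'. f (resampled X X' Z t \<omega>')) \<omega>"
proof -
  interpret resampling_setting M E X X' Z by fact
  \<comment> \<open>\<open>L2_seq\<close> lives on the restricted measure, so measurability is
    carried over to \<open>M\<close>.\<close>
  have "F \<in> borel_measurable M"
    using assms(3) measurable_from_subalg[OF subalgebra_sigma_seq]
      measurable_in_subalg'[OF subalgebra_sigma_seq]
    unfolding L2_seq_def L2_def by blast
  then show ?thesis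
    using assms(2,4) unfolding OU_semigroup_def representative_def
    by (intro AE_L2_sum_eq L2_has_sum_hoeffding_real_cond_exp) auto
qed

end
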